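(* Let $m,n>1$. For lower semicontinuous functions $f:\mathbb{R}^{nm}\to\mathbb{R}$, strong Morrey quasiconvexity and weak Morrey quasiconvexity are not equivalent; that is (since strong Morrey quasiconvexity always implies weak Morrey quasiconvexity), there is a lower semicontinuous function $f:\mathbb{R}^{nm}\to\mathbb{R}$ which is weak Morrey quasiconvex but not strong Morrey quasiconvex.
   Context: Let $Q$ be the unit cube in $\mathbb{R}^n$. For $\varphi=(\varphi_1,\dots,\varphi_m)\in W^{1,\infty}(Q,\mathbb{R}^m)$, the gradient $D\varphi(x)$ is regarded as the element $(D\varphi_1(x),\dots,D\varphi_m(x))$ of $\mathbb{R}^{nm}$, with $D\varphi_i(x)\in\mathbb{R}^n$. $W^{1,\infty}_0(Q,\mathbb{R}^m)$ is the set of $\varphi\in W^{1,\infty}(Q,\mathbb{R}^m)$ with $\varphi=0$ on $\partial Q$. Functions $f$ are defined at every point, not just almost everywhere. Strong Morrey quasiconvexity: a measurable function $f:\mathbb{R}^{nm}\to\mathbb{R}$ is (strong) Morrey quasiconvex if for every $\epsilon>0$, every $A\in\mathbb{R}^{nm}$ and every $K>0$ there exists $\delta=\delta(\epsilon,K,A)>0$ such that, whenever $\varphi\in W^{1,\infty}(Q,\mathbb{R}^m)$ satisfies $\|D\varphi\|_{L^\infty}\le K$ and $\max_{x\in\partial Q}|\varphi(x)|\le\delta$, one has $$f(A)\le \operatorname*{ess\,sup}_{x\in Q} f(A+D\varphi(x))+\epsilon.$$ Weak Morrey quasiconvexity: a measurable function $f:\mathbb{R}^{nm}\to\mathbb{R}$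 is weak Morrey quasiconvex (also called $(0,0)$ Morrey quasiconvex) if for every $A\in\mathbb{R}^{nm}$ and every $\varphi\in W^{1,\infty}_0(Q,\mathbb{R}^m)$ one has $$f(A)\le \operatorname*{ess\,sup}_{x\in Q} f(A+D\varphi(x)).$$ *)

theory Defs
  imports "HOL-Analysis.Analysis" "HOL-Probability.Essential_Supremum"
begin

definition unit_cube :: "(real ^ 'n) set" where
  "unit_cube = box 0 1"

definition lower_semicontinuous :: "('a::topological_space \<Rightarrow> real) \<Rightarrow> bool" where
  "lower_semicontinuous f \<longleftrightarrow> (\<forall>x. ereal (f x) \<le> Liminf (at x) (\<lambda>y. ereal (f y)))"

definition partial_deriv :: "'n \<Rightarrow> (real ^ 'n \<Rightarrow> real) \<Rightarrow> real ^ 'n \<Rightarrow> real" where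
  "partial_deriv j \<psi> x = frechet_derivative \<psi> (at x) (axis j 1)"

primrec Ck :: "nat \<Rightarrow> (real ^ 'n \<Rightarrow> real) \<Rightarrow> bool" where
  "Ck 0 \<psi> \<longleftrightarrow> continuous_on UNIV \<psi>"
| "Ck (Suc k) \<psi> \<longleftrightarrow> \<psi> differentiable_on UNIV \<and> (\<forall>j. Ck k (partial_deriv j \<psi>))"

text \<open>Members of \<open>C\<^sub>c\<^sup>\<infinity>(\<Omega>)\<close>, extended by zero to the whole space.\<close>

definition test_function :: "(real ^ 'n) set \<Rightarrow> (real ^ 'n \<Rightarrow> real) \<Rightarrow> bool" where
  "test_function \<Omega> \<psi> \<longleftrightarrow>
     (\<forall>k. Ck k \<psi>) \<and> compact (closure {x. \<psi> x \<noteq> 0}) \<and> closure {x. \<psi> x \<noteq> 0} \<subseteq> \<Omega>"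

definition Linf_norm :: "(real ^ 'n) set \<Rightarrow> (real ^ 'n \<Rightarrow> 'b::euclidean_space) \<Rightarrow> ereal" where
  "Linf_norm \<Omega> g = esssup (lebesgue_on \<Omega>) (\<lambda>x. ereal (norm (g x)))"

definition Linf :: "(real ^ 'n) set \<Rightarrow> (real ^ 'n \<Rightarrow> 'b::euclidean_space) \<Rightarrow> bool" where
  "Linf \<Omega> g \<longleftrightarrow> g \<in> borel_measurable (lebesgue_on \<Omega>) \<and> Linf_norm \<Omega> g < \<infinity>"

text \<open>Row \<open>i\<close> of the matrix \<open>G x\<close> is the (weak) gradient of the component \<open>\<phi>\<^sub>i\<close> at \<open>x\<close>; the type
  \<open>real ^ 'n ^ 'm\<close> of \<open>m\<close>-tuples of vectors in \<open>\<real>\<^sup>n\<close> carries the Euclidean norm of \<open>\<real>\<^bsup>nm\<^esup>\<close>.\<close>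

definition weak_gradient ::
    "(real ^ 'n) set \<Rightarrow> (real ^ 'n \<Rightarrow> real ^ 'm) \<Rightarrow> (real ^ 'n \<Rightarrow> real ^ 'n ^ 'm) \<Rightarrow> bool" where
  "weak_gradient \<Omega> \<phi> G \<longleftrightarrow>
     (\<forall>\<psi>. test_function \<Omega> \<psi> \<longrightarrow>
        (\<forall>i j. (LINT x|lebesgue_on \<Omega>. \<phi> x $ i * partial_deriv j \<psi> x)
             = - (LINT x|lebesgue_on \<Omega>. G x $ i $ j * \<psi> x)))"

text \<open>\<open>W1inf \<phi> G\<close>: \<open>\<phi>\<close> belongs to \<open>W\<^bsup>1,\<infinity>\<^esup>(Q, \<real>\<^sup>m)\<close> and \<open>G\<close> is a version of \<open>D\<phi>\<close>.
  Every class in \<open>W\<^bsup>1,\<infinity>\<^esup>(Q, \<real>\<^sup>m)\<close> has exactly one representative that is continuous on the closed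
  cube. The classes are identified with these representatives, which gives the pointwise values
  on the boundary their meaning.\<close>

definition W1inf :: "(real ^ 'n \<Rightarrow> real ^ 'm) \<Rightarrow> (real ^ 'n \<Rightarrow> real ^ 'n ^ 'm) \<Rightarrow> bool" where
  "W1inf \<phi> G \<longleftrightarrow>
     continuous_on (closure unit_cube) \<phi> \<and> Linf unit_cube \<phi> \<and>
     Linf unit_cube G \<and> weak_gradient unit_cube \<phi> G"

definition W1inf0 :: "(real ^ 'n \<Rightarrow> real ^ 'm) \<Rightarrow> (real ^ 'n \<Rightarrow> real ^ 'n ^ 'm) \<Rightarrow> bool" where
  "W1inf0 \<phi> G \<longleftrightarrow> W1inf \<phi> G \<and> (\<forall>x\<in>frontier unit_cube. \<phi> x = 0)"

definition strong_Morrey_quasiconvex :: "(real ^ 'n ^ 'm \<Rightarrow> real) \<Rightarrow> bool" where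
  "strong_Morrey_quasiconvex f \<longleftrightarrow>
     f \<in> borel_measurable borel \<and>
     (\<forall>\<epsilon>>0. \<forall>A. \<forall>K>0. \<exists>\<delta>>0. \<forall>\<phi> G.
        W1inf \<phi> G \<and> Linf_norm unit_cube G \<le> ereal K \<and>
        (\<forall>x\<in>frontier unit_cube. norm (\<phi> x) \<le> \<delta>) \<longrightarrow>
        ereal (f A) \<le> esssup (lebesgue_on unit_cube) (\<lambda>x. ereal (f (A + G x))) + ereal \<epsilon>)"

definition weak_Morrey_quasiconvex :: "(real ^ 'n ^ 'm \<Rightarrow> real) \<Rightarrow> bool" where
  "weak_Morrey_quasiconvex f \<longleftrightarrow>
     f \<in> borel_measurable borel \<and>
     (\<forall>A \<phi> G. W1inf0 \<phi> G \<longrightarrow>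
        ereal (f A) \<le> esssup (lebesgue_on unit_cube) (\<lambda>x. ereal (f (A + G x))))"

lemma strong_imp_weak_Morrey_quasiconvex:
  fixes f :: "real ^ 'n ^ 'm \<Rightarrow> real"
  assumes "strong_Morrey_quasiconvex f"
  shows "weak_Morrey_quasiconvex f"
  unfolding weak_Morrey_quasiconvex_def
proof (intro conjI allI impI)
  show "f \<in> borel_measurable borel"
    using assms by (simp add: strong_Morrey_quasiconvex_def)
next
  fix A and \<phi> :: "real ^ 'n \<Rightarrow> real ^ 'm" and G assume W: "W1inf0 \<phi> G"
  then have "Linf_norm unit_cube G < \<infinity>"
    by (simp add: W1inf0_def W1inf_def Linf_def)
  then obtain k :: real where k: "Linf_norm unit_cube G \<le> ereal k"
    by (metis ereal_dense2 less_imp_le)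
  define K where "K = max k 1"
  have K: "K > 0" "Linf_norm unit_cube G \<le> ereal K"
    using k by (auto simp: K_def intro: order_trans)
  show "ereal (f A) \<le> esssup (lebesgue_on unit_cube) (\<lambda>x. ereal (f (A + G x)))"
  proof (rule ereal_le_epsilon2)
    fix \<epsilon> :: real assume "0 < \<epsilon>"
    with assms K(1) obtain \<delta> where "\<delta> > 0" and \<delta>: "\<forall>(\<phi> :: real ^ 'n \<Rightarrow> real ^ 'm) G.
        W1inf \<phi> G \<and> Linf_norm unit_cube G \<le> ereal K \<and>
        (\<forall>x\<in>frontier unit_cube. norm (\<phi> x) \<le> \<delta>) \<longrightarrow>
        ereal (f A) \<le> esssup (lebesgue_on unit_cube) (\<lambda>x. ereal (f (A + G x))) + ereal \<epsilon>"
      unfolding strong_Morrey_quasiconvex_def by blast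
    from W have "W1inf \<phi> G" "\<forall>x\<in>frontier unit_cube. norm (\<phi> x) \<le> \<delta>"
      using \<open>\<delta> > 0\<close> by (auto simp: W1inf0_def)
    with \<delta> K(2)
    show "ereal (f A) \<le> esssup (lebesgue_on unit_cube) (\<lambda>x. ereal (f (A + G x))) + ereal \<epsilon>"
      by blast
  qed
qed

end

theory Submission
  imports Defs "HOL-Computational_Algebra.Polynomial"
begin

text \<open>Fix a row \<open>i\<close> and two columns \<open>j \<noteq> k\<close>, and let \<open>f\<close> be the indicator function of the complement of
  the closed set \<open>E = {X. \<bar>X\<^sub>i\<^sub>j\<bar> = 1 \<and> X\<^sub>i\<^sub>k = 0}\<close>.

  The origin is not in \<open>E\<close>, but zigzags in the variable \<open>x\<^sub>j\<close> with slopes \<open>\<plusminus>1\<close> and arbitrarily small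
  amplitude have gradients in \<open>E\<close>, so strong quasiconvexity fails at \<open>A = 0\<close>.

  For weak quasiconvexity, suppose that \<open>A + D\<phi> \<in> E\<close> almost everywhere and \<open>\<phi>\<close> vanishes on the boundary.
  Then \<open>\<phi>\<^sub>i\<close> has the constant weak derivative \<open>- A\<^sub>i\<^sub>k\<close> in the direction \<open>x\<^sub>k\<close>, so it is affine on every
  line in that direction. As it vanishes at both ends of each such segment, \<open>A\<^sub>i\<^sub>k = 0\<close> and \<open>\<phi>\<^sub>i = 0\<close>;
  hence \<open>D\<phi>\<^sub>i = 0\<close> and \<open>A \<in> E\<close>.\<close>

section \<open>Smooth bump functions\<close>

text \<open>With \<open>p = 1\<close> this is the classical smooth function
  \<open>exp (- 1 / x)\<close>, extended by zero to \<open>x \<le> 0\<close>. The polynomial in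
  \<open>1 / x\<close> is included because differentiation then stays inside the family.\<close>

definition flat_exp :: "real poly \<Rightarrow> real \<Rightarrow> real" where
  "flat_exp p x = (if x > 0 then poly p (inverse x) * exp (- inverse x) else 0)"

lemma tendsto_poly_mult_exp_minus_0:
  "((\<lambda>y. poly p y * exp (- y)) \<longlongrightarrow> (0::real)) at_top"
proof -
  have "((\<lambda>y. \<Sum>i\<le>degree p. coeff p i * (y ^ i / exp y)) \<longlongrightarrow> (\<Sum>i\<le>degree p. coeff p i * 0)) at_top"
    by (intro tendsto_intros tendsto_power_div_exp_0)
  then show ?thesis
    by (simp add: poly_altdef sum_distrib_right exp_minus divide_inverse mult.assoc)
qed

text \<open>With \<open>y = 1 / x\<close>, the chain rule turns \<open>p(y) exp(-y)\<close> into
  \<open>y^2 (p(y) - p'(y)) exp(-y)\<close>, and \<open>[:0, 0, 1:]\<close> is the factor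
  \<open>y^2\<close>. Only the point 0 needs a limit argument.\<close>

lemma flat_exp_has_field_derivative:
  "(flat_exp p has_real_derivative flat_exp ([:0, 0, 1:] * (p - pderiv p)) x) (at x)"
proof (cases x "0::real" rule: linorder_cases)
  case less
  have "(flat_exp p has_real_derivative 0) (at x)"
    by (rule has_field_derivative_transform_within_open[of "\<lambda>_. 0" _ _ "{..<0}"])
       (use less in \<open>auto simp: flat_exp_def\<close>)
  with less show ?thesis by (simp add: flat_exp_def)
next
  case equal
  \<comment> \<open>The difference quotient at 0 contributes one more factor \<open>1 / y\<close>;
    \<open>pCons 0 p\<close> absorbs it, so the exponential decay still applies.\<close>
  have "((\<lambda>y. poly (pCons 0 p) (inverse y) * exp (- inverse y)) \<longlongrightarrow> 0) (at_right 0)"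
    by (rule filterlim_compose[OF tendsto_poly_mult_exp_minus_0 filterlim_inverse_at_top_right])
  then have "((\<lambda>y. flat_exp p y / y) \<longlongrightarrow> 0) (at_right 0)"
    by (rule Lim_transform_eventually)
       (auto simp: eventually_at_filter flat_exp_def field_simps)
  moreover have "((\<lambda>y. flat_exp p y / y) \<longlongrightarrow> 0) (at_left 0)"
    by (rule tendsto_eventually) (auto simp: eventually_at_filter flat_exp_def)
  ultimately have "((\<lambda>y. flat_exp p y / y) \<longlongrightarrow> 0) (at 0)"
    by (simp add: filterlim_split_at_real)
  then have "(flat_exp p has_real_derivative 0) (at 0)"
    by (simp add: has_field_derivative_iff flat_exp_def)
  with equal show ?thesis by (simp add: flat_exp_def)
next
  case greater
  have "((\<lambda>y. poly p (inverse y) * exp (- inverse y)) has_real_derivative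
          flat_exp ([:0, 0, 1:] * (p - pderiv p)) x) (at x)"
    using greater
    by (auto intro!: derivative_eq_intros poly_DERIV[THEN DERIV_chain2]
             simp: flat_exp_def power2_eq_square algebra_simps)
  then show ?thesis
    by (rule has_field_derivative_transform_within_open[of _ _ _ "{0<..}"])
       (use greater in \<open>auto simp: flat_exp_def\<close>)
qed

text \<open>An algebra that is closed under partial derivatives: this gives smoothness of its members
  without a Leibniz formula for higher derivatives.\<close>

inductive_set flat_exp_algebra :: "(real ^ 'n \<Rightarrow> real) set" where
  const: "(\<lambda>x. c) \<in> flat_exp_algebra"
| flat: "(\<lambda>x. flat_exp p (c * x $ j + d)) \<in> flat_exp_algebra"
| add: "u \<in> flat_exp_algebra \<Longrightarrow> v \<in> flat_exp_algebra \<Longrightarrow> (\<lambda>x. u x + v x) \<in> flat_exp_algebra"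
| mult: "u \<in> flat_exp_algebra \<Longrightarrow> v \<in> flat_exp_algebra \<Longrightarrow> (\<lambda>x. u x * v x) \<in> flat_exp_algebra"

lemma flat_exp_algebra_prod:
  assumes "finite S" "\<And>i. i \<in> S \<Longrightarrow> F i \<in> flat_exp_algebra"
  shows "(\<lambda>x. \<Prod>i\<in>S. F i x) \<in> flat_exp_algebra"
  using assms by (induction S rule: finite_induct) (auto intro: flat_exp_algebra.intros)

text \<open>Induction over the generation of the algebra: generators differentiate to constant
  multiples of generators, and the sum and product rules do the rest. One \<open>D\<close> is chosen
  for all points, so that \<open>x \<mapsto> D x (axis j 1)\<close> is a function whose membership
  can be asserted.\<close>

lemma flat_exp_algebra_derivative:
  assumes "\<psi> \<in> flat_exp_algebra"
  shows "\<exists>D. \<forall>x. (\<psi> has_derivative D x) (at x) \<and> (\<forall>j. (\<lambda>x. D x (axis j 1)) \<in> flat_exp_algebra)"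
  using assms
proof induction
  case (const c)
  show ?case
    by (rule exI[of _ "\<lambda>x h. 0"]) (auto intro: flat_exp_algebra.const)
next
  case (flat p c j d)
  let ?q = "[:0, 0, 1:] * (p - pderiv p)"
  show ?case
  proof (rule exI[of _ "\<lambda>x h. c * h $ j * flat_exp ?q (c * x $ j + d)"], intro allI conjI)
    fix x :: "real ^ 'a" and i
    have "((\<lambda>x::real ^ 'a. c * x $ j + d) has_derivative (\<lambda>h. c * h $ j)) (at x)"
      by (auto intro!: derivative_eq_intros bounded_linear_imp_has_derivative[OF bounded_linear_vec_nth])
    from has_derivative_compose[OF this
        flat_exp_has_field_derivative[unfolded has_field_derivative_def]]
    show "((\<lambda>x. flat_exp p (c * x $ j + d)) has_derivative
            (\<lambda>h. c * h $ j * flat_exp ?q (c * x $ j + d))) (at x)"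
      by (simp add: mult.commute)
    show "(\<lambda>x. c * axis i 1 $ j * flat_exp ?q (c * x $ j + d)) \<in> flat_exp_algebra"
      by (intro flat_exp_algebra.intros)
  qed
next
  case (add u v)
  then obtain D E where "\<And>x. (u has_derivative D x) (at x)" "\<And>x. (v has_derivative E x) (at x)"
    "\<And>j. (\<lambda>x. D x (axis j 1)) \<in> flat_exp_algebra" "\<And>j. (\<lambda>x. E x (axis j 1)) \<in> flat_exp_algebra"
    by metis
  then show ?case
    by (intro exI[of _ "\<lambda>x h. D x h + E x h"])
       (auto intro!: has_derivative_add flat_exp_algebra.intros)
next
  case (mult u v)
  then obtain D E where "\<And>x. (u has_derivative D x) (at x)" "\<And>x. (v has_derivative E x) (at x)"
    "\<And>j. (\<lambda>x. D x (axis j 1)) \<in> flat_exp_algebra" "\<And>j. (\<lambda>x. E x (axis j 1)) \<in> flat_exp_algebra"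
    by metis
  with mult.hyps show ?case
    by (intro exI[of _ "\<lambda>x h. u x * E x h + D x h * v x"])
       (auto intro!: has_derivative_mult flat_exp_algebra.intros)
qed

lemma
  assumes "\<psi> \<in> flat_exp_algebra"
  shows flat_exp_algebra_differentiable: "\<psi> differentiable (at x)"
    and flat_exp_algebra_partial_deriv: "partial_deriv j \<psi> \<in> flat_exp_algebra"
proof -
  from flat_exp_algebra_derivative[OF assms] obtain D where
    D: "\<And>x. (\<psi> has_derivative D x) (at x)" "\<And>j. (\<lambda>x. D x (axis j 1)) \<in> flat_exp_algebra"
    by metis
  show "\<psi> differentiable (at x)"
    using D(1) by (auto simp: differentiable_def)
  have "partial_deriv j \<psi> = (\<lambda>x. D x (axis j 1))"
    using frechet_derivative_at[OF D(1)] by (simp add: partial_deriv_def fun_eq_iff)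
  then show "partial_deriv j \<psi> \<in> flat_exp_algebra"
    using D(2) by simp
qed

lemma flat_exp_algebra_Ck: "\<psi> \<in> flat_exp_algebra \<Longrightarrow> Ck k \<psi>"
proof (induction k arbitrary: \<psi>)
  case 0
  then show ?case
    using flat_exp_algebra_differentiable
    by (auto simp: continuous_on_eq_continuous_at intro: differentiable_imp_continuous_within)
next
  case (Suc k)
  then show ?case
    by (simp add: differentiable_on_def flat_exp_algebra_differentiable flat_exp_algebra_partial_deriv)
qed

text \<open>Each pair of factors is positive exactly between two opposite faces of the box. The
  parameter \<open>k\<close> steepens the factors: as \<open>k\<close> grows the bump approaches the
  indicator of the open box.\<close>

definition box_bump :: "real \<Rightarrow> real ^ 'n \<Rightarrow> real ^ 'n \<Rightarrow> real ^ 'n \<Rightarrow> real" where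
  "box_bump k a b x = (\<Prod>j\<in>UNIV. flat_exp 1 (k * (x $ j - a $ j)) * flat_exp 1 (k * (b $ j - x $ j)))"

lemma box_bump_in_flat_exp_algebra: "box_bump k a b \<in> flat_exp_algebra"
proof -
  have *: "k * (x $ j - a $ j) = k * x $ j + (- k * a $ j)"
      "k * (b $ j - x $ j) = (- k) * x $ j + k * b $ j" for x j
    by (auto simp: algebra_simps)
  show ?thesis
    unfolding box_bump_def[abs_def] * by (intro flat_exp_algebra_prod flat_exp_algebra.intros) auto
qed

lemma flat_exp_1_bounds: "0 \<le> flat_exp 1 x" "flat_exp 1 x \<le> 1"
  by (auto simp: flat_exp_def)

lemma box_bump_bounds: "0 \<le> box_bump k a b x" "box_bump k a b x \<le> 1"
  unfolding box_bump_def
  by (auto intro!: prod_nonneg prod_le_1 mult_nonneg_nonneg mult_le_one flat_exp_1_bounds)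

lemma box_bump_pos_iff:
  assumes "k > 0"
  shows "box_bump k a b x > 0 \<longleftrightarrow> x \<in> box a b"
proof
  assume "box_bump k a b x > 0"
  then have "\<forall>j. flat_exp 1 (k * (x $ j - a $ j)) \<noteq> 0 \<and> flat_exp 1 (k * (b $ j - x $ j)) \<noteq> 0"
    unfolding box_bump_def by (metis (no_types, lifting) UNIV_I finite mult_eq_0_iff order_less_irrefl prod_zero_iff)
  with assms show "x \<in> box a b"
    by (auto simp: mem_box_cart flat_exp_def zero_less_mult_iff split: if_splits)
next
  assume "x \<in> box a b"
  with assms show "box_bump k a b x > 0"
    unfolding box_bump_def by (intro prod_pos) (auto simp: mem_box_cart flat_exp_def)
qed

lemma box_bump_nonzero_iff: "k > 0 \<Longrightarrow> box_bump k a b x \<noteq> 0 \<longleftrightarrow> x \<in> box a b"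
  by (metis box_bump_bounds(1) box_bump_pos_iff less_eq_real_def order_less_irrefl)

lemma test_function_box_bump:
  assumes "k > 0" "cbox a b \<subseteq> \<Omega>"
  shows "test_function \<Omega> (box_bump k a b)"
proof -
  have "closure {x. box_bump k a b x \<noteq> 0} \<subseteq> cbox a b"
    using assms(1) by (intro closure_minimal) (auto simp: box_bump_nonzero_iff box_subset_cbox[THEN subsetD])
  moreover from this have "compact (closure {x. box_bump k a b x \<noteq> 0})"
    by (metis bounded_cbox bounded_subset closed_closure compact_eq_bounded_closed)
  ultimately show ?thesis
    using assms box_bump_in_flat_exp_algebra flat_exp_algebra_Ck unfolding test_function_def by blast
qed

lemma box_bump_translate: "box_bump k (a + v) (b + v) x = box_bump k a b (x - v)"
  by (simp add: box_bump_def algebra_simps)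

text \<open>Inside the box every factor is \<open>exp (- 1 / (k y))\<close> with a fixed
  \<open>y > 0\<close>, which tends to 1; outside the open box the bump is 0 for every
  \<open>k\<close>. Thus convergence holds at every point, boundary included.\<close>

lemma box_bump_tendsto_indicator:
  "(\<lambda>i. box_bump (real (Suc i)) a b x) \<longlonglongrightarrow> indicator (box a b) x"
proof (cases "x \<in> box a b")
  case True
  have *: "(\<lambda>i. flat_exp 1 (real (Suc i) * y)) \<longlonglongrightarrow> 1" if "y > 0" for y :: real
  proof -
    have "(\<lambda>i. exp (- (inverse (real (Suc i)) * inverse y))) \<longlonglongrightarrow> exp (- (0 * inverse y))"
      by (intro tendsto_intros LIMSEQ_inverse_real_of_nat)
    with that show ?thesis by (simp add: flat_exp_def)
  qed
  have "(\<lambda>i. box_bump (real (Suc i)) a b x) \<longlonglongrightarrow> (\<Prod>j\<in>(UNIV::'a set). 1 * 1)"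
    unfolding box_bump_def using True
    by (intro tendsto_prod tendsto_mult *) (auto simp: mem_box_cart)
  with True show ?thesis by simp
next
  case False
  then have "box_bump (real (Suc i)) a b x = 0" for i
    using box_bump_nonzero_iff[of "real (Suc i)" a b x] by simp
  with False show ?thesis by simp
qed

section \<open>Integration by parts against test functions\<close>

lemma integral_lborel_translate:
  fixes f :: "'a::euclidean_space \<Rightarrow> real"
  assumes "f \<in> borel_measurable borel"
  shows "(LINT x|lborel. f (v + x)) = (LINT x|lborel. f x)"
proof -
  have "(LINT x|lborel. f x) = (LINT x|distr lborel borel ((+) v). f x)"
    by (simp only: lborel_distr_plus)
  also have "\<dots> = (LINT x|lborel. f (v + x))"
    using assms by (intro integral_distr) auto
  finally show ?thesis ..
qed

lemma integrable_lborel_compact_support: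
  fixes F :: "'a::euclidean_space \<Rightarrow> real"
  assumes "continuous_on UNIV F" "compact K" "\<And>x. x \<notin> K \<Longrightarrow> F x = 0"
  shows "integrable lborel F"
proof -
  have "integrable lborel (\<lambda>x. indicator K x *\<^sub>R F x)"
    using assms by (intro borel_integrable_compact) (auto intro: continuous_on_subset)
  moreover have "(\<lambda>x. indicator K x *\<^sub>R F x) = F"
    using assms(3) by (auto simp: fun_eq_iff indicator_def)
  ultimately show ?thesis by simp
qed

lemma test_functionD:
  fixes \<psi> :: "real ^ 'n \<Rightarrow> real"
  assumes "test_function \<Omega> \<psi>"
  shows "continuous_on UNIV \<psi>" "\<psi> differentiable (at x)" "continuous_on UNIV (partial_deriv j \<psi>)"
    "x \<notin> closure {x. \<psi> x \<noteq> 0} \<Longrightarrow> \<psi> x = 0"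
    "x \<notin> closure {x. \<psi> x \<noteq> 0} \<Longrightarrow> partial_deriv j \<psi> x = 0"
proof -
  have k: "Ck k \<psi>" for k
    using assms by (auto simp: test_function_def)
  show "continuous_on UNIV \<psi>" using k[of 0] by simp
  show "\<psi> differentiable (at x)" using k[of 1] by (simp add: differentiable_on_def)
  show "continuous_on UNIV (partial_deriv j \<psi>)" using k[of "Suc 0"] by simp
  have zero: "\<psi> x = 0" if "x \<notin> closure {x. \<psi> x \<noteq> 0}" for x
    using that closure_subset[of "{x. \<psi> x \<noteq> 0}"] by blast
  then show "\<psi> x = 0" if "x \<notin> closure {x. \<psi> x \<noteq> 0}"
    using that .
  show "partial_deriv j \<psi> x = 0" if x: "x \<notin> closure {x. \<psi> x \<noteq> 0}"
  proof -
    have "(\<psi> has_derivative (\<lambda>h. 0)) (at x)"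
      by (rule has_derivative_transform_within_open[of "\<lambda>_. 0" _ _ _ "- closure {x. \<psi> x \<noteq> 0}"])
         (use x in \<open>auto intro!: zero\<close>)
    from frechet_derivative_at[OF this, symmetric] show ?thesis
      by (simp add: partial_deriv_def)
  qed
qed

lemma partial_deriv_line:
  fixes \<psi> :: "real ^ 'n \<Rightarrow> real"
  assumes "\<And>x. \<psi> differentiable (at x)"
  shows "((\<lambda>t. \<psi> (x + t *\<^sub>R axis j 1)) has_real_derivative partial_deriv j \<psi> (x + t *\<^sub>R axis j 1)) (at t)"
proof -
  let ?D = "frechet_derivative \<psi> (at (x + t *\<^sub>R axis j 1))"
  have D: "(\<psi> has_derivative ?D) (at (x + t *\<^sub>R axis j 1))"
    using assms by (simp add: frechet_derivative_works)
  have "((\<lambda>t. x + t *\<^sub>R axis j 1) has_derivative (\<lambda>h. h *\<^sub>R axis j 1)) (at t)"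
    by (auto intro!: derivative_eq_intros)
  from has_derivative_compose[OF this D]
  have "((\<lambda>t. \<psi> (x + t *\<^sub>R axis j 1)) has_derivative (\<lambda>h. ?D (h *\<^sub>R axis j 1))) (at t)" .
  moreover have "(\<lambda>h. ?D (h *\<^sub>R axis j 1)) = (*) (partial_deriv j \<psi> (x + t *\<^sub>R axis j 1))"
    using D[THEN has_derivative_linear, THEN linear_scale]
    by (simp add: partial_deriv_def fun_eq_iff mult.commute)
  ultimately show ?thesis by (simp add: has_field_derivative_def)
qed

text \<open>The partial derivative is continuous and vanishes off a compact set, hence is bounded;
  the mean value inequality on lines gives the constant. It dominates the difference quotients of
  \<open>\<psi>\<close> below.\<close>

lemma test_function_Lipschitz_line:
  fixes \<psi> :: "real ^ 'n \<Rightarrow> real"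
  assumes \<psi>: "test_function \<Omega> \<psi>"
  obtains C where "C \<ge> 0" "\<And>x h. \<bar>\<psi> (x + h *\<^sub>R axis j 1) - \<psi> x\<bar> \<le> C * \<bar>h\<bar>"
proof -
  let ?K = "closure {x. \<psi> x \<noteq> 0}"
  have "compact (partial_deriv j \<psi> ` ?K)"
    using \<psi> test_functionD(3)[OF \<psi>]
    by (intro compact_continuous_image) (auto simp: test_function_def intro: continuous_on_subset)
  then obtain C where C: "C > 0" "\<And>x. x \<in> ?K \<Longrightarrow> \<bar>partial_deriv j \<psi> x\<bar> \<le> C"
    by (auto dest!: compact_imp_bounded simp: bounded_pos)
  have C': "\<bar>partial_deriv j \<psi> x\<bar> \<le> C" for x
    using C test_functionD(5)[OF \<psi>, of x j] by (cases "x \<in> ?K") auto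
  have "\<bar>\<psi> (x + h *\<^sub>R axis j 1) - \<psi> x\<bar> \<le> C * \<bar>h\<bar>" for x h
    using field_differentiable_bound[of UNIV "\<lambda>t. \<psi> (x + t *\<^sub>R axis j 1)"
        "\<lambda>t. partial_deriv j \<psi> (x + t *\<^sub>R axis j 1)" C h 0]
      partial_deriv_line[OF test_functionD(2)[OF \<psi>]] C' by simp
  then show thesis using that C(1) less_imp_le by blast
qed

text \<open>Difference quotients are moved from \<open>\<psi>\<close> to \<open>\<phi>\<close> by translation invariance; no Fubini is needed.\<close>

lemma Lipschitz_integration_by_parts:
  fixes \<phi> \<psi> g :: "real ^ 'n \<Rightarrow> real"
  assumes L: "\<And>x y. \<bar>\<phi> x - \<phi> y\<bar> \<le> L * norm (x - y)"
    and D: "AE x in lborel. ((\<lambda>h. (\<phi> (x + h *\<^sub>R axis j 1) - \<phi> x) / h) \<longlongrightarrow> g x) (at 0)"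
    and g [measurable]: "g \<in> borel_measurable borel"
    and \<psi>: "test_function \<Omega> \<psi>"
  shows "(LINT x|lborel. \<phi> x * partial_deriv j \<psi> x) = - (LINT x|lborel. g x * \<psi> x)"
proof -
  define e :: "real ^ 'n" where "e = axis j 1"
  have ne: "norm e = 1" by (simp add: e_def)
  define h where "h k = inverse (real (Suc k))" for k
  have h: "h k > 0" "h k \<le> 1" for k
    by (auto simp: h_def field_simps)
  have h0: "h \<longlonglongrightarrow> 0"
    unfolding h_def by (rule LIMSEQ_inverse_real_of_nat)
  define K where "K = closure {x. \<psi> x \<noteq> 0}"
  have K: "compact K" using \<psi> by (simp add: test_function_def K_def)
  have \<psi>0: "\<psi> x = 0" if "x \<notin> K" for x
    using that unfolding K_def by (rule test_functionD(4)[OF \<psi>])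
  obtain R where R: "\<And>x. x \<in> K \<Longrightarrow> norm x \<le> R"
    using K compact_imp_bounded[of K] by (auto simp: bounded_iff)
  have c\<psi>: "continuous_on UNIV \<psi>" using \<psi> by (rule test_functionD)
  have "L-lipschitz_on UNIV \<phi>"
  proof (rule lipschitz_onI)
    show "0 \<le> L" using L[of e 0] ne by auto
  qed (use L in \<open>auto simp: dist_norm\<close>)
  then have c\<phi>: "continuous_on UNIV \<phi>"
    by (rule lipschitz_on_continuous_on)
  have [measurable]: "\<phi> \<in> borel_measurable borel" "\<psi> \<in> borel_measurable borel"
    "partial_deriv j \<psi> \<in> borel_measurable borel"
    using c\<phi> c\<psi> test_functionD(3)[OF \<psi>] by (auto intro: borel_measurable_continuous_onI)
  have "compact (\<phi> ` cball 0 (R + 1))"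
    using c\<phi> by (intro compact_continuous_image) (auto intro: continuous_on_subset)
  then obtain B where B: "B > 0" "\<And>x. norm x \<le> R + 1 \<Longrightarrow> \<bar>\<phi> x\<bar> \<le> B"
    by (auto dest!: compact_imp_bounded simp: bounded_pos)
  obtain C where C: "C \<ge> 0" "\<And>x h. \<bar>\<psi> (x + h *\<^sub>R e) - \<psi> x\<bar> \<le> C * \<bar>h\<bar>"
    using test_function_Lipschitz_line[OF \<psi>] unfolding e_def by blast
  \<comment> \<open>Since all step lengths \<open>h k\<close> are at most 1, the shifted supports
    remain in the ball of radius \<open>R + 1\<close>, which carries the dominating
    function.\<close>
  have far: "\<psi> (x + t *\<^sub>R e) = 0" if "norm x > R + 1" "\<bar>t\<bar> \<le> 1" for x t
  proof (rule \<psi>0)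
    have "norm x \<le> norm (x + t *\<^sub>R e) + norm (t *\<^sub>R e)"
      using norm_triangle_ineq4[of "x + t *\<^sub>R e" "t *\<^sub>R e"] by simp
    with that have "norm (x + t *\<^sub>R e) > R" by (simp add: ne)
    then show "x + t *\<^sub>R e \<notin> K" using R by force
  qed
  have lim1: "(\<lambda>k. LINT x|lborel. \<phi> x * ((\<psi> (x + h k *\<^sub>R e) - \<psi> x) / h k))
      \<longlonglongrightarrow> (LINT x|lborel. \<phi> x * partial_deriv j \<psi> x)"
  proof (rule integral_dominated_convergence)
    show "integrable lborel (\<lambda>x::real ^ 'n. indicator (cball 0 (R + 1)) x *\<^sub>R (B * C))"
      by (intro borel_integrable_compact) auto
    show "AE x in lborel. (\<lambda>k. \<phi> x * ((\<psi> (x + h k *\<^sub>R e) - \<psi> x) / h k)) \<longlonglongrightarrow> \<phi> x * partial_deriv j \<psi> x"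
    proof (intro AE_I2 tendsto_mult tendsto_const)
      fix x
      have "((\<lambda>t. (\<psi> (x + t *\<^sub>R e) - \<psi> x) / t) \<longlongrightarrow> partial_deriv j \<psi> x) (at 0)"
        using partial_deriv_line[OF test_functionD(2)[OF \<psi>], of x j 0]
        by (simp add: has_field_derivative_iff e_def)
      then show "(\<lambda>k. (\<psi> (x + h k *\<^sub>R e) - \<psi> x) / h k) \<longlonglongrightarrow> partial_deriv j \<psi> x"
        by (rule filterlim_compose) (use h0 h(1) in \<open>auto simp: filterlim_at less_imp_neq[symmetric]\<close>)
    qed
    show "AE x in lborel. norm (\<phi> x * ((\<psi> (x + h k *\<^sub>R e) - \<psi> x) / h k))
             \<le> indicator (cball 0 (R + 1)) x *\<^sub>R (B * C)" for k
    proof (rule AE_I2)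
      fix x
      show "norm (\<phi> x * ((\<psi> (x + h k *\<^sub>R e) - \<psi> x) / h k)) \<le> indicator (cball 0 (R + 1)) x *\<^sub>R (B * C)"
      proof (cases "norm x \<le> R + 1")
        case True
        have "\<bar>(\<psi> (x + h k *\<^sub>R e) - \<psi> x) / h k\<bar> \<le> C"
          using C(2)[of x "h k"] h(1)[of k] by (simp add: field_simps)
        then have "\<bar>\<phi> x\<bar> * \<bar>(\<psi> (x + h k *\<^sub>R e) - \<psi> x) / h k\<bar> \<le> B * C"
          using B True by (intro mult_mono) auto
        with True show ?thesis by (simp add: abs_mult)
      next
        case False
        then show ?thesis using far[of x "h k"] far[of x 0] h[of k] by simp
      qed
    qed
  qed measurable
  \<comment> \<open>The quotient divides a step by \<open>- h k\<close> by \<open>+ h k\<close>, so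
    its limit is \<open>- g x\<close>; this produces the sign of the integration by parts. The
    Lipschitz constant supplies the dominating function
    \<open>L * \<bar>\<psi> x\<bar>\<close>.\<close>
  have lim2: "(\<lambda>k. LINT x|lborel. ((\<phi> (x - h k *\<^sub>R e) - \<phi> x) / h k) * \<psi> x)
      \<longlonglongrightarrow> (LINT x|lborel. - (g x * \<psi> x))"
  proof (rule integral_dominated_convergence)
    show "integrable lborel (\<lambda>x. L * \<bar>\<psi> x\<bar>)"
      by (rule integrable_lborel_compact_support[OF _ K])
         (simp_all add: \<psi>0 continuous_on_mult_left continuous_on_rabs c\<psi>)
    show "AE x in lborel. (\<lambda>k. ((\<phi> (x - h k *\<^sub>R e) - \<phi> x) / h k) * \<psi> x) \<longlonglongrightarrow> - (g x * \<psi> x)"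
      using D
    proof (rule AE_mp, intro AE_I2 impI)
      fix x assume "((\<lambda>h. (\<phi> (x + h *\<^sub>R axis j 1) - \<phi> x) / h) \<longlongrightarrow> g x) (at 0)"
      moreover have "filterlim (\<lambda>k. - h k) (at 0) sequentially"
        using tendsto_minus[OF h0] h(1) by (auto simp: filterlim_at less_imp_neq[symmetric])
      ultimately have "(\<lambda>k. (\<phi> (x + (- h k) *\<^sub>R axis j 1) - \<phi> x) / (- h k)) \<longlonglongrightarrow> g x"
        by (rule filterlim_compose)
      from tendsto_mult[OF tendsto_minus[OF this] tendsto_const[of "\<psi> x"]]
      show "(\<lambda>k. ((\<phi> (x - h k *\<^sub>R e) - \<phi> x) / h k) * \<psi> x) \<longlonglongrightarrow> - (g x * \<psi> x)"
        by (simp add: e_def)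
    qed
    show "AE x in lborel. norm (((\<phi> (x - h k *\<^sub>R e) - \<phi> x) / h k) * \<psi> x) \<le> L * \<bar>\<psi> x\<bar>" for k
    proof (rule AE_I2)
      fix x
      have "\<bar>(\<phi> (x - h k *\<^sub>R e) - \<phi> x) / h k\<bar> \<le> L"
        using L[of "x - h k *\<^sub>R e" x] h(1)[of k] ne by (simp add: field_simps)
      then show "norm (((\<phi> (x - h k *\<^sub>R e) - \<phi> x) / h k) * \<psi> x) \<le> L * \<bar>\<psi> x\<bar>"
        unfolding real_norm_def abs_mult by (rule mult_right_mono) simp
    qed
  qed measurable
  \<comment> \<open>Discrete integration by parts: translation by \<open>h k\<close> in direction
    \<open>e\<close> moves the shift from \<open>\<psi>\<close> to \<open>\<phi>\<close>, and the
    unshifted terms agree. Integrability of the three products justifies splitting the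
    integrals.\<close>
  have eq: "(LINT x|lborel. \<phi> x * ((\<psi> (x + h k *\<^sub>R e) - \<psi> x) / h k)) =
        (LINT x|lborel. ((\<phi> (x - h k *\<^sub>R e) - \<phi> x) / h k) * \<psi> x)" for k
  proof -
    have shift: "continuous_on UNIV (\<lambda>x. F (x + v))" if "continuous_on UNIV F" for F :: "real ^ 'n \<Rightarrow> real" and v
      by (rule continuous_on_compose2[OF that]) (auto intro: continuous_intros)
    have i1: "integrable lborel (\<lambda>x. \<phi> x * \<psi> (x + h k *\<^sub>R e))"
      by (rule integrable_lborel_compact_support[of _ "cball 0 (R + 1)"])
         (use far[of _ "h k"] h[of k] in \<open>simp_all add: continuous_on_mult c\<phi> shift[OF c\<psi>]\<close>)
    have i2: "integrable lborel (\<lambda>x. \<phi> x * \<psi> x)"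
      by (rule integrable_lborel_compact_support[OF _ K])
         (simp_all add: \<psi>0 continuous_on_mult c\<phi> c\<psi>)
    have i3: "integrable lborel (\<lambda>x. \<phi> (x - h k *\<^sub>R e) * \<psi> x)"
      by (rule integrable_lborel_compact_support[OF _ K])
         (simp_all add: \<psi>0 continuous_on_mult c\<psi> shift[OF c\<phi>, of "- h k *\<^sub>R e", simplified])
    have "(LINT x|lborel. \<phi> x * \<psi> (x + h k *\<^sub>R e)) = (LINT x|lborel. \<phi> (x - h k *\<^sub>R e) * \<psi> x)"
      using integral_lborel_translate[of "\<lambda>x. \<phi> (x - h k *\<^sub>R e) * \<psi> x" "h k *\<^sub>R e"]
      by (simp add: add.commute)
    with i1 i2 i3 have "(LINT x|lborel. (\<phi> x * \<psi> (x + h k *\<^sub>R e) - \<phi> x * \<psi> x) / h k) =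
        (LINT x|lborel. (\<phi> (x - h k *\<^sub>R e) * \<psi> x - \<phi> x * \<psi> x) / h k)"
      by simp
    then show ?thesis by (simp add: algebra_simps diff_divide_distrib)
  qed
  show ?thesis
    using LIMSEQ_unique[OF lim1[unfolded eq] lim2] by simp
qed

lemma integral_lebesgue_on_support:
  fixes f :: "'a::euclidean_space \<Rightarrow> real"
  assumes f: "f \<in> borel_measurable borel" and S: "S \<in> sets lebesgue" and "\<And>x. x \<notin> S \<Longrightarrow> f x = 0"
  shows "(LINT x|lebesgue_on S. f x) = (LINT x|lborel. f x)"
proof -
  have "(LINT x|lebesgue_on S. f x) = (LINT x|lebesgue. (if x \<in> S then f x else 0))"
    using S by (rule Lebesgue_Measure.integral_restrict_UNIV[symmetric])
  also have "(\<lambda>x. if x \<in> S then f x else 0) = f"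
    using assms(3) by auto
  also have "(LINT x|lebesgue. f x) = (LINT x|lborel. f x)"
    using f by (intro integral_completion) simp
  finally show ?thesis .
qed

text \<open>Both integrands vanish outside \<open>\<Omega>\<close>, so the integrals may be taken
  over the whole space, where translation invariance is available.\<close>

lemma test_function_Lipschitz_integration_by_parts:
  fixes \<phi> \<psi> g :: "real ^ 'n \<Rightarrow> real"
  assumes L: "\<And>x y. \<bar>\<phi> x - \<phi> y\<bar> \<le> L * norm (x - y)"
    and D: "AE x in lborel. ((\<lambda>h. (\<phi> (x + h *\<^sub>R axis j 1) - \<phi> x) / h) \<longlongrightarrow> g x) (at 0)"
    and g [measurable]: "g \<in> borel_measurable borel"
    and \<psi>: "test_function \<Omega> \<psi>" and \<Omega>: "\<Omega> \<in> sets lebesgue"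
  shows "(LINT x|lebesgue_on \<Omega>. \<phi> x * partial_deriv j \<psi> x) = - (LINT x|lebesgue_on \<Omega>. g x * \<psi> x)"
proof -
  have sub: "closure {x. \<psi> x \<noteq> 0} \<subseteq> \<Omega>"
    using \<psi> by (simp add: test_function_def)
  have zero: "\<psi> x = 0" "partial_deriv j \<psi> x = 0" if "x \<notin> \<Omega>" for x
    using that sub test_functionD(4,5)[OF \<psi>] by blast+
  have "continuous_on UNIV \<phi>"
  proof (rule lipschitz_on_continuous_on[of L], rule lipschitz_onI)
    show "0 \<le> L" using L[of "axis j 1" 0] by auto
  qed (use L in \<open>auto simp: dist_norm\<close>)
  then have [measurable]: "\<phi> \<in> borel_measurable borel" "\<psi> \<in> borel_measurable borel"
    "partial_deriv j \<psi> \<in> borel_measurable borel"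
    using test_functionD(1,3)[OF \<psi>] by (auto intro: borel_measurable_continuous_onI)
  have "(LINT x|lebesgue_on \<Omega>. \<phi> x * partial_deriv j \<psi> x) = (LINT x|lborel. \<phi> x * partial_deriv j \<psi> x)"
    by (rule integral_lebesgue_on_support[OF _ \<Omega>]) (simp_all add: zero)
  moreover have "(LINT x|lebesgue_on \<Omega>. g x * \<psi> x) = (LINT x|lborel. g x * \<psi> x)"
    by (rule integral_lebesgue_on_support[OF _ \<Omega>]) (simp_all add: zero)
  ultimately show ?thesis
    using Lipschitz_integration_by_parts[OF L D g \<psi>] by simp
qed

section \<open>Functions with a constant weak partial derivative\<close>

text \<open>The radius comes from bounding the Euclidean norm by the sum of the coordinates. Stating
  the inclusion for every \<open>s \<le> r\<close> allows a caller to combine several radii by a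
  minimum.\<close>

lemma open_contains_cube:
  fixes p :: "real ^ 'n"
  assumes "open S" "p \<in> S"
  obtains r where "r > 0" "\<And>s. s \<le> r \<Longrightarrow> cbox (p - vec s) (p + vec s) \<subseteq> S"
proof -
  obtain \<rho> where \<rho>: "\<rho> > 0" "ball p \<rho> \<subseteq> S"
    using assms open_contains_ball by blast
  define r where "r = \<rho> / (2 * real CARD('n))"
  have "r > 0" using \<rho> by (simp add: r_def)
  moreover have "cbox (p - vec s) (p + vec s) \<subseteq> S" if s: "s \<le> r" for s
  proof
    fix x assume x: "x \<in> cbox (p - vec s) (p + vec s)"
    have "norm (x - p) \<le> (\<Sum>i\<in>UNIV. \<bar>(x - p) $ i\<bar>)"
      by (rule norm_le_l1_cart)
    also have "\<dots> \<le> (\<Sum>i\<in>(UNIV::'n set). r)"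
    proof (rule sum_mono)
      fix i
      have "p $ i - s \<le> x $ i" "x $ i \<le> p $ i + s"
        using x by (auto simp: mem_box_cart)
      with s show "\<bar>(x - p) $ i\<bar> \<le> r" by simp
    qed
    also have "\<dots> < \<rho>" using \<rho> by (simp add: r_def)
    finally show "x \<in> S" using \<rho>(2) by (auto simp: dist_norm norm_minus_commute)
  qed
  ultimately show thesis using that by blast
qed

text \<open>Bumps converging to indicators show that \<open>g\<close> has integral zero over every
  box whose closure lies in \<open>\<Omega>\<close>. By Lebesgue differentiation, almost every value
  of \<open>g\<close> is a limit of averages over such boxes.\<close>

lemma fundamental_lemma_calculus_of_variations:
  fixes g :: "real ^ 'n \<Rightarrow> real"
  assumes \<Omega>: "open \<Omega>" and g: "integrable (lebesgue_on \<Omega>) g"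
    and weak: "\<And>\<psi>. test_function \<Omega> \<psi> \<Longrightarrow> (LINT x|lebesgue_on \<Omega>. g x * \<psi> x) = 0"
  shows "AE x in lebesgue_on \<Omega>. g x = 0"
proof -
  define g0 where "g0 x = (if x \<in> \<Omega> then g x else 0)" for x
  have \<Omega>': "\<Omega> \<in> sets lebesgue" using \<Omega> by simp
  have int: "integrable lebesgue g0"
    unfolding g0_def[abs_def] using g by (simp add: Lebesgue_Measure.integrable_restrict_UNIV \<Omega>')
  then have "g0 integrable_on UNIV" by (rule integrable_on_lebesgue)
  then have "g0 integrable_on cbox a b" for a b
    by (rule integrable_on_subcbox) auto
  \<comment> \<open>Outside \<open>N\<close>, the averages over the cubes with lower corner
    \<open>x\<close> converge to \<open>g0 x\<close>.\<close>
  then obtain N where N: "negligible N" and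
    diff: "\<And>x e. x \<notin> N \<Longrightarrow> 0 < e \<Longrightarrow> \<exists>d>0. \<forall>h. 0 < h \<and> h < d \<longrightarrow>
      norm (integral (cbox x (x + h *\<^sub>R One)) g0 /\<^sub>R h ^ DIM(real ^ 'n) - g0 x) < e"
    using integrable_ccontinuous_explicit[of g0] by metis
  have zero: "integral (cbox a b) g0 = 0" if ab: "cbox a b \<subseteq> \<Omega>" for a b
  proof -
    have "(\<lambda>i. LINT x|lebesgue_on \<Omega>. g x * box_bump (real (Suc i)) a b x)
        \<longlonglongrightarrow> (LINT x|lebesgue_on \<Omega>. g x * indicator (box a b) x)"
    proof (rule integral_dominated_convergence)
      show "integrable (lebesgue_on \<Omega>) (\<lambda>x. \<bar>g x\<bar>)" using g by simp
      show "AE x in lebesgue_on \<Omega>. (\<lambda>i. g x * box_bump (real (Suc i)) a b x) \<longlonglongrightarrow> g x * indicator (box a b) x"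
        by (intro AE_I2 tendsto_mult tendsto_const box_bump_tendsto_indicator)
      show "AE x in lebesgue_on \<Omega>. norm (g x * box_bump (real (Suc i)) a b x) \<le> \<bar>g x\<bar>" for i
        using box_bump_bounds(1,2)[of "real (Suc i)" a b]
        by (intro AE_I2) (auto simp: abs_mult intro!: mult_left_le)
      have [measurable]: "g \<in> borel_measurable (lebesgue_on \<Omega>)" using g by auto
      have [measurable]: "(indicator (box a b) :: _ \<Rightarrow> real) \<in> borel_measurable (lebesgue_on \<Omega>)"
        by (intro measurable_restrict_space1 measurable_completion) simp
      show "(\<lambda>x. g x * indicator (box a b) x) \<in> borel_measurable (lebesgue_on \<Omega>)"
        by measurable
      have "box_bump (real (Suc i)) a b \<in> borel_measurable borel" for i
        using flat_exp_algebra_Ck[where k = 0, OF box_bump_in_flat_exp_algebra[of "real (Suc i)" a b]]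
        by (simp add: borel_measurable_continuous_onI)
      then have [measurable]: "box_bump (real (Suc i)) a b \<in> borel_measurable (lebesgue_on \<Omega>)" for i
        by (intro measurable_restrict_space1 measurable_completion) simp
      show "(\<lambda>x. g x * box_bump (real (Suc i)) a b x) \<in> borel_measurable (lebesgue_on \<Omega>)" for i
        by measurable
    qed
    moreover have "(LINT x|lebesgue_on \<Omega>. g x * box_bump (real (Suc i)) a b x) = 0" for i
      using ab by (intro weak test_function_box_bump) auto
    ultimately have "(LINT x|lebesgue_on \<Omega>. g x * indicator (box a b) x) = 0"
      by (simp add: LIMSEQ_const_iff)
    moreover have "(LINT x|lebesgue_on \<Omega>. g x * indicator (box a b) x) =
        (LINT x|lebesgue. (if x \<in> \<Omega> then g x * indicator (box a b) x else 0))"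
      by (rule Lebesgue_Measure.integral_restrict_UNIV[OF \<Omega>', symmetric])
    moreover have "(\<lambda>x. if x \<in> \<Omega> then g x * indicator (box a b) x else 0) =
        (\<lambda>x. if x \<in> box a b then g0 x else 0)"
      by (auto simp: g0_def fun_eq_iff)
    moreover have "(LINT x|lebesgue. (if x \<in> box a b then g0 x else 0)) = integral (box a b) g0"
    proof -
      have "integrable lebesgue (\<lambda>x. indicator (box a b) x *\<^sub>R g0 x)"
        using int by (intro integrable_mult_indicator) auto
      then have "integrable (lebesgue_on (box a b)) g0"
        by (simp add: integrable_restrict_space)
      then show ?thesis
        by (subst Lebesgue_Measure.integral_restrict_UNIV) (auto intro: lebesgue_integral_eq_integral)
    qed
    ultimately show ?thesis
      by (simp add: integral_open_interval)
  qed
  have "g x = 0" if x: "x \<in> \<Omega>" "x \<notin> N" for x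
  proof (rule ccontr)
    assume "g x \<noteq> 0"
    \<comment> \<open>The tolerance \<open>\<bar>g x\<bar>\<close> suffices: once an average is 0,
      the estimate reads \<open>\<bar>g x\<bar> < \<bar>g x\<bar>\<close>.\<close>
    then obtain d where d: "d > 0" "\<And>h. 0 < h \<Longrightarrow> h < d \<Longrightarrow>
      norm (integral (cbox x (x + h *\<^sub>R One)) g0 /\<^sub>R h ^ DIM(real ^ 'n) - g0 x) < \<bar>g x\<bar>"
      using diff[OF x(2), of "\<bar>g x\<bar>"] by auto
    obtain r where r: "r > 0" "\<And>s. s \<le> r \<Longrightarrow> cbox (x - vec s) (x + vec s) \<subseteq> \<Omega>"
      using open_contains_cube[OF \<Omega> x(1)] by metis
    define h where "h = min r (d / 2)"
    have h: "0 < h" "h < d" "h \<le> r" using d r by (auto simp: h_def)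
    have "(One :: real ^ 'n) $ i = 1" for i
      by (simp add: cart_eq_inner_axis)
    then have One: "(One :: real ^ 'n) = vec 1"
      by (simp only: vec_eq_iff vec_component) simp
    have "cbox x (x + h *\<^sub>R One) \<subseteq> cbox (x - vec h) (x + vec h)"
    proof
      fix y assume "y \<in> cbox x (x + h *\<^sub>R One)"
      then have "x $ i \<le> y $ i \<and> y $ i \<le> x $ i + h" for i
        unfolding One by (simp add: mem_box_cart)
      with h(1) have "x $ i - h \<le> y $ i \<and> y $ i \<le> x $ i + h" for i
        by (meson add_increasing2 diff_le_eq less_imp_le order_trans)
      then show "y \<in> cbox (x - vec h) (x + vec h)"
        by (simp add: mem_box_cart)
    qed
    with r(2)[OF h(3)] have "integral (cbox x (x + h *\<^sub>R One)) g0 = 0"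
      by (intro zero) auto
    with d(2)[OF h(1,2)] x(1) show False by (simp add: g0_def)
  qed
  moreover have "AE x in lebesgue. x \<notin> N"
    using N by (simp add: negligible_iff_null_sets AE_not_in)
  ultimately show ?thesis
    using \<Omega>' by (auto simp: AE_restrict_space_iff elim!: AE_mp)
qed

text \<open>Weak gradients are stated with Lebesgue integrals over the open box, whereas
  differentiation under the integral and the vanishing criterion for continuous integrands are
  applied to gauge integrals over the closed box.\<close>

lemma integral_lebesgue_on_box:
  fixes f :: "real ^ 'n \<Rightarrow> real"
  assumes "continuous_on (cbox a b) f"
  shows "(LINT x|lebesgue_on (box a b). f x) = integral (cbox a b) f"
proof -
  have "set_integrable lebesgue (box a b) f"
    by (rule set_integrable_subset[OF absolutely_integrable_continuous[OF assms]])
       (auto simp: box_subset_cbox)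
  then have "integrable (lebesgue_on (box a b)) f"
    by (simp add: set_integrable_def integrable_restrict_space)
  then show ?thesis
    by (simp add: lebesgue_integral_eq_integral integral_open_interval)
qed

text \<open>If \<open>W = u - c x\<^sub>j - m\<close> were negative near \<open>p\<close> and positive near \<open>p + T e\<^sub>j\<close>, then the integral of \<open>W\<close>
  against a bump sliding from \<open>p\<close> to \<open>p + T e\<^sub>j\<close> would change sign, but its derivative in time is zero.\<close>

lemma weak_constant_deriv_upper_bound:
  fixes u :: "real ^ 'n \<Rightarrow> real"
  assumes u: "continuous_on (cbox a b) u"
    and weak: "\<And>\<psi>. test_function (box a b) \<psi> \<Longrightarrow>
      (LINT x|lebesgue_on (box a b). u x * partial_deriv j \<psi> x) = - (LINT x|lebesgue_on (box a b). c * \<psi> x)"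
    and p: "p \<in> box a b" and q: "p + T *\<^sub>R axis j 1 \<in> box a b" and T: "T \<ge> 0"
  shows "u (p + T *\<^sub>R axis j 1) \<le> u p + c * T"
proof (rule ccontr)
  define e :: "real ^ 'n" where "e = axis j 1"
  have ej: "e $ i = (if i = j then 1 else 0)" for i by (simp add: e_def axis_def)
  assume "\<not> ?thesis"
  then have less: "u p - c * p $ j < u (p + T *\<^sub>R e) - c * (p + T *\<^sub>R e) $ j"
    by (simp add: e_def ej algebra_simps)
  \<comment> \<open>The midpoint of the two values of \<open>u - c x\<^sub>j\<close>; subtracting it
    gives \<open>W\<close> opposite signs at the two points.\<close>
  define m where "m = ((u p - c * p $ j) + (u (p + T *\<^sub>R e) - c * (p + T *\<^sub>R e) $ j)) / 2"
  define W where "W x = u x - (c * x $ j + m)" for x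
  have W: "W p < 0" "W (p + T *\<^sub>R e) > 0"
    using less unfolding W_def m_def by (simp_all add: field_simps)
  have cW: "continuous_on (cbox a b) W"
    unfolding W_def[abs_def] by (intro continuous_intros u)
  then have cW': "continuous_on (box a b) W"
    using box_subset_cbox continuous_on_subset by blast
  have "open (box a b \<inter> W -` {..<0})" "open (box a b \<inter> W -` {0<..})"
    using cW' by (auto intro!: continuous_open_preimage)
  then obtain r1 r2 where r1: "r1 > 0" "\<And>s. s \<le> r1 \<Longrightarrow> cbox (p - vec s) (p + vec s) \<subseteq> box a b \<inter> W -` {..<0}"
    and r2: "r2 > 0" "\<And>s. s \<le> r2 \<Longrightarrow> cbox (p + T *\<^sub>R e - vec s) (p + T *\<^sub>R e + vec s) \<subseteq> box a b \<inter> W -` {0<..}"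
    using open_contains_cube[of _ p] open_contains_cube[of _ "p + T *\<^sub>R e"] W p q
    by (metis (no_types, lifting) Int_iff e_def greaterThan_iff lessThan_iff vimageI)
  define r where "r = min r1 r2"
  have r: "r > 0" using r1 r2 by (simp add: r_def)
  have cube1: "cbox (p - vec r) (p + vec r) \<subseteq> box a b \<inter> W -` {..<0}"
    and cube2: "cbox (p + T *\<^sub>R e - vec r) (p + T *\<^sub>R e + vec r) \<subseteq> box a b \<inter> W -` {0<..}"
    using r1(2)[of r] r2(2)[of r] by (auto simp: r_def)
  define w where "w = box_bump 1 (p - vec r) (p + vec r)"
  have wt: "(\<lambda>x. w (x - t *\<^sub>R e)) = box_bump 1 (p - vec r + t *\<^sub>R e) (p + vec r + t *\<^sub>R e)" for t
    by (simp add: w_def box_bump_translate fun_eq_iff)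
  have w_alg: "w \<in> flat_exp_algebra" unfolding w_def by (rule box_bump_in_flat_exp_algebra)
  have cw: "continuous_on UNIV w" "continuous_on UNIV (partial_deriv j w)"
    using flat_exp_algebra_Ck[OF w_alg, of "Suc 0"] flat_exp_algebra_Ck[OF w_alg, of 0] by auto
  \<comment> \<open>The sliding cube lies between its two end positions, both inside the box, and
    only coordinate \<open>j\<close> moves; hence its closure never leaves the box.\<close>
  have test: "test_function (box a b) (\<lambda>x. w (x - t *\<^sub>R e))" if t: "t \<in> {0..T}" for t
    unfolding wt
  proof (rule test_function_box_bump)
    have "a $ i < p $ i - r" "p $ i + r < b $ i" "p $ i + T * e $ i + r < b $ i" for i
    proof -
      have "p - vec r \<in> box a b" "p + vec r \<in> box a b" "p + T *\<^sub>R e + vec r \<in> box a b"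
        using cube1[THEN subsetD, of "p - vec r"] cube1[THEN subsetD, of "p + vec r"]
          cube2[THEN subsetD, of "p + T *\<^sub>R e + vec r"] r
        by (simp_all add: mem_box_cart)
      then show "a $ i < p $ i - r" "p $ i + r < b $ i" "p $ i + T * e $ i + r < b $ i"
        by (auto simp: mem_box_cart)
    qed
    moreover have "0 \<le> t * e $ i" "t * e $ i \<le> T * e $ i" for i
      using t by (auto simp: ej)
    ultimately show "cbox (p - vec r + t *\<^sub>R e) (p + vec r + t *\<^sub>R e) \<subseteq> box a b"
      by (auto simp: mem_box_cart) (smt (verit))+
  qed simp
  have pd: "partial_deriv j (\<lambda>x. w (x - t *\<^sub>R e)) x = partial_deriv j w (x - t *\<^sub>R e)" for t x
  proof (rule DERIV_unique)
    have alg: "(\<lambda>x. w (x - t *\<^sub>R e)) \<in> flat_exp_algebra"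
      unfolding wt by (rule box_bump_in_flat_exp_algebra)
    show "((\<lambda>s. w (x + s *\<^sub>R e - t *\<^sub>R e)) has_real_derivative
          partial_deriv j (\<lambda>x. w (x - t *\<^sub>R e)) x) (at 0)"
      using partial_deriv_line[OF flat_exp_algebra_differentiable[OF alg], of x j 0] by (simp add: e_def)
    show "((\<lambda>s. w (x + s *\<^sub>R e - t *\<^sub>R e)) has_real_derivative partial_deriv j w (x - t *\<^sub>R e)) (at 0)"
      using partial_deriv_line[OF flat_exp_algebra_differentiable[OF w_alg], of "x - t *\<^sub>R e" j 0]
      by (simp add: e_def algebra_simps)
  qed
  have shift: "continuous_on S (\<lambda>x. F (x - t *\<^sub>R e))" if "continuous_on UNIV F"
    for F :: "real ^ 'n \<Rightarrow> real" and t S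
    by (rule continuous_on_compose2[OF that]) (auto intro: continuous_intros)
  \<comment> \<open>Both \<open>u\<close> and the affine function \<open>c x\<^sub>j + m\<close>
    have weak derivative \<open>c\<close> in direction \<open>j\<close>, so their difference
    \<open>W\<close> integrates to zero against the partial derivative of every translate of the
    bump.\<close>
  have I0: "integral (cbox a b) (\<lambda>x. W x * partial_deriv j w (x - t *\<^sub>R e)) = 0" if t: "t \<in> {0..T}" for t
  proof -
    let ?\<psi> = "\<lambda>x. w (x - t *\<^sub>R e)"
    have cp: "continuous_on S (partial_deriv j ?\<psi>)" for S
      unfolding pd by (rule shift[OF cw(2)])
    have 1: "integral (cbox a b) (\<lambda>x. u x * partial_deriv j ?\<psi> x) = - integral (cbox a b) (\<lambda>x. c * ?\<psi> x)"
      using weak[OF test[OF t]]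
      by (subst (asm) (1 2) integral_lebesgue_on_box)
         (auto intro!: continuous_on_mult u cp shift[OF cw(1)])
    have "(LINT x|lebesgue_on (box a b). (c * x $ j + m) * partial_deriv j ?\<psi> x)
        = - (LINT x|lebesgue_on (box a b). c * ?\<psi> x)"
    proof (rule test_function_Lipschitz_integration_by_parts[OF _ _ _ test[OF t]])
      show "\<bar>c * x $ j + m - (c * y $ j + m)\<bar> \<le> \<bar>c\<bar> * norm (x - y)" for x y :: "real ^ 'n"
        using component_le_norm_cart[of "x - y" j]
        by (simp add: abs_mult right_diff_distrib[symmetric] mult_left_mono)
      show "AE x in lborel. ((\<lambda>h. (c * (x + h *\<^sub>R axis j 1) $ j + m - (c * x $ j + m)) / h) \<longlongrightarrow> c) (at 0)"
      proof (rule AE_I2, rule tendsto_eventually)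
        fix x :: "real ^ 'n"
        show "\<forall>\<^sub>F h in at 0. (c * (x + h *\<^sub>R axis j 1) $ j + m - (c * x $ j + m)) / h = c"
          by (auto simp: eventually_at_filter field_simps)
      qed
    qed auto
    then have 2: "integral (cbox a b) (\<lambda>x. (c * x $ j + m) * partial_deriv j ?\<psi> x) = - integral (cbox a b) (\<lambda>x. c * ?\<psi> x)"
      by (subst (asm) (1 2) integral_lebesgue_on_box)
         (auto intro!: continuous_on_mult continuous_on_add continuous_on_component cp shift[OF cw(1)])
    have "integral (cbox a b) (\<lambda>x. u x * partial_deriv j ?\<psi> x - (c * x $ j + m) * partial_deriv j ?\<psi> x)
        = integral (cbox a b) (\<lambda>x. u x * partial_deriv j ?\<psi> x) - integral (cbox a b) (\<lambda>x. (c * x $ j + m) * partial_deriv j ?\<psi> x)"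
      by (intro Henstock_Kurzweil_Integration.integral_diff integrable_continuous)
         (auto intro!: continuous_on_mult continuous_on_add continuous_on_component u cp)
    with 1 2 show ?thesis
      by (simp add: W_def left_diff_distrib pd)
  qed
  define F where "F t = integral (cbox a b) (\<lambda>x. W x * w (x - t *\<^sub>R e))" for t
  \<comment> \<open>Differentiating under the integral, the time derivative of the bump is minus its
    partial derivative in direction \<open>j\<close>, so \<open>I0\<close> applies.\<close>
  have "(F has_real_derivative 0) (at t within {0..T})" if t: "t \<in> {0..T}" for t
  proof -
    have "((\<lambda>t. integral (cbox a b) (\<lambda>x. W x * w (x - t *\<^sub>R e))) has_field_derivative
        integral (cbox a b) (\<lambda>x. W x * - partial_deriv j w (x - t *\<^sub>R e))) (at t within {0..T})"
    proof (rule leibniz_rule_field_derivative)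
      fix s x
      have "((\<lambda>s. w (x + s *\<^sub>R e)) has_real_derivative partial_deriv j w (x + (- s) *\<^sub>R e)) (at (- s))"
        using partial_deriv_line[OF flat_exp_algebra_differentiable[OF w_alg], of x j "- s"]
        by (simp add: e_def)
      from DERIV_mirror[THEN iffD1, OF this]
      have "((\<lambda>s. w (x - s *\<^sub>R e)) has_real_derivative - partial_deriv j w (x - s *\<^sub>R e)) (at s)"
        by simp
      from DERIV_cmult[OF this, of "W x"]
      show "((\<lambda>t. W x * w (x - t *\<^sub>R e)) has_real_derivative W x * - partial_deriv j w (x - s *\<^sub>R e)) (at s within {0..T})"
        by (rule has_field_derivative_at_within)
    next
      show "(\<lambda>x. W x * w (x - s *\<^sub>R e)) integrable_on cbox a b" for s
        by (intro integrable_continuous continuous_on_mult cW shift[OF cw(1)])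
      have "continuous_on ({0..T} \<times> cbox a b) (\<lambda>z. W (snd z) * - partial_deriv j w (snd z - fst z *\<^sub>R e))"
        by (intro continuous_on_mult continuous_on_minus continuous_on_compose2[OF cW]
             continuous_on_compose2[OF cw(2)] continuous_intros) auto
      then show "continuous_on ({0..T} \<times> cbox a b) (\<lambda>(s, x). W x * - partial_deriv j w (x - s *\<^sub>R e))"
        by (simp add: case_prod_beta)
    qed (use t in auto)
    then show ?thesis using I0[OF t] by (simp add: F_def[abs_def])
  qed
  then obtain k where "\<forall>t\<in>{0..T}. F t = k"
    using has_field_derivative_zero_constant[of "{0..T}" F] by auto
  then have FT: "F T = F 0" using T by auto
  have c0: "continuous_on (cbox a b) (\<lambda>x. W x * w (x - t *\<^sub>R e))" for t
    by (intro continuous_on_mult cW shift[OF cw(1)])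
  have wpos: "w x > 0 \<longleftrightarrow> x \<in> box (p - vec r) (p + vec r)" "w x \<ge> 0" for x
    by (auto simp: w_def box_bump_pos_iff box_bump_bounds)
  have neg: "W x * w x \<le> 0" for x
  proof (cases "w x > 0")
    case True
    then have "x \<in> cbox (p - vec r) (p + vec r)"
      using wpos box_subset_cbox by blast
    then have "W x < 0" using cube1 by auto
    with True show ?thesis by (simp add: mult_neg_pos less_imp_le)
  qed (use wpos(2)[of x] in simp)
  have pos: "W x * w (x - T *\<^sub>R e) \<ge> 0" for x
  proof (cases "w (x - T *\<^sub>R e) > 0")
    case True
    then have "x - T *\<^sub>R e \<in> cbox (p - vec r) (p + vec r)"
      using wpos box_subset_cbox by blast
    then have "x \<in> cbox (p + T *\<^sub>R e - vec r) (p + T *\<^sub>R e + vec r)"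
      by (auto simp: mem_box_cart algebra_simps)
    then have "W x > 0" using cube2 by auto
    with True show ?thesis by simp
  qed (use wpos(2)[of "x - T *\<^sub>R e"] in simp)
  have "integral (cbox a b) (\<lambda>x. W x * w (x - T *\<^sub>R e) - W x * w (x - 0 *\<^sub>R e)) = F T - F 0"
    unfolding F_def by (intro Henstock_Kurzweil_Integration.integral_diff integrable_continuous c0)
  then have "integral (cbox a b) (\<lambda>x. W x * w (x - T *\<^sub>R e) - W x * w x) = 0"
    using FT by simp
  moreover have "continuous_on (cbox a b) (\<lambda>x. W x * w (x - T *\<^sub>R e) - W x * w x)"
    using continuous_on_diff[OF c0[of T] c0[of 0]] by simp
  \<comment> \<open>The integrand is continuous and, by \<open>neg\<close> and \<open>pos\<close>,
    nonnegative; having integral zero, it vanishes identically. At \<open>p\<close> this is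
    impossible, because \<open>- W p * w p > 0\<close>.\<close>
  ultimately have "\<forall>x\<in>cbox a b. W x * w (x - T *\<^sub>R e) - W x * w x = 0"
    using neg pos p by (subst (asm) integral_cbox_eq_0_iff) (auto intro: order_trans)
  then have "W p * w (p - T *\<^sub>R e) - W p * w p = 0"
    using p box_subset_cbox by blast
  moreover have "w p > 0"
    using r by (simp add: wpos mem_box_cart)
  ultimately show False
    using W(1) pos[of p] by (smt (verit) mult_neg_pos)
qed

text \<open>The upper bound for \<open>u\<close> and for \<open>- u\<close> together give equality;
  for negative \<open>T\<close> the two end points exchange roles.\<close>

lemma weak_constant_deriv_imp_affine:
  fixes u :: "real ^ 'n \<Rightarrow> real"
  assumes u: "continuous_on (cbox a b) u"
    and weak: "\<And>\<psi>. test_function (box a b) \<psi> \<Longrightarrow>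
      (LINT x|lebesgue_on (box a b). u x * partial_deriv j \<psi> x) = - (LINT x|lebesgue_on (box a b). c * \<psi> x)"
    and p: "p \<in> box a b" and q: "p + T *\<^sub>R axis j 1 \<in> box a b"
  shows "u (p + T *\<^sub>R axis j 1) = u p + c * T"
proof -
  have weak': "(LINT x|lebesgue_on (box a b). - u x * partial_deriv j \<psi> x) = - (LINT x|lebesgue_on (box a b). - c * \<psi> x)"
    if "test_function (box a b) \<psi>" for \<psi>
    using weak[OF that] by simp
  have up: "u (p + T *\<^sub>R axis j 1) \<le> u p + c * T" "u (p + T *\<^sub>R axis j 1) \<ge> u p + c * T"
    if "p \<in> box a b" "p + T *\<^sub>R axis j 1 \<in> box a b" "T \<ge> 0" for p T
    using weak_constant_deriv_upper_bound[OF u _ that, of c]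
      weak_constant_deriv_upper_bound[OF continuous_on_minus[OF u] _ that, of "- c"] weak weak' by auto
  show ?thesis
  proof (cases "T \<ge> 0")
    case True
    then show ?thesis using up[OF p q] by simp
  next
    case False
    then show ?thesis using up[of "p + T *\<^sub>R axis j 1" "- T"] p q by simp
  qed
qed

section \<open>The counterexample\<close>

text \<open>The distance to the nearest integer: a sawtooth of period 1 with slopes 1 and
  -1.\<close>

definition zigzag :: "real \<Rightarrow> real" where
  "zigzag t = \<bar>t - of_int (round t)\<bar>"

lemma zigzag_bounds: "0 \<le> zigzag t" "zigzag t \<le> 1/2"
  unfolding zigzag_def using of_int_round_abs_le[of t] by (auto simp: abs_minus_commute)

text \<open>The integer nearest to \<open>t\<close> is also a competitor in the minimum that defines
  the distance from \<open>s\<close> to the integers.\<close>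

lemma zigzag_Lipschitz: "\<bar>zigzag s - zigzag t\<bar> \<le> \<bar>s - t\<bar>"
proof -
  have "zigzag s \<le> zigzag t + \<bar>s - t\<bar>" for s t
    using round_diff_minimal[of s "round t"] unfolding zigzag_def by linarith
  from this[of s t] this[of t s] show ?thesis by linarith
qed

lemma zigzag_has_field_derivative:
  assumes "2 * t \<notin> \<int>"
  shows "(zigzag has_real_derivative sgn (t - of_int (round t))) (at t)"
proof -
  define n where "n = round t"
  \<comment> \<open>The three excluded points are the kink \<open>n\<close> and the half-integers
    \<open>n + 1/2\<close> and \<open>n - 1/2\<close> where \<open>round\<close> changes. Thus
    \<open>t\<close> lies strictly inside an interval on which the nearest integer is constantly
    \<open>n\<close>.\<close>
  have "2 * t \<noteq> of_int (2 * n)" "2 * t \<noteq> of_int (2 * n + 1)" "2 * t \<noteq> of_int (2 * n - 1)"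
    using assms Ints_of_int by metis+
  moreover have "\<bar>t - of_int n\<bar> \<le> 1/2"
    using zigzag_bounds(2)[of t] by (simp add: zigzag_def n_def)
  ultimately have n: "\<bar>t - of_int n\<bar> < 1/2" "t \<noteq> of_int n"
    by (auto simp: abs_if split: if_splits)
  have "((\<lambda>s. \<bar>s - of_int n\<bar>) has_real_derivative sgn (t - of_int n)) (at t)"
  proof (cases "t > of_int n")
    case True
    show ?thesis
      by (rule has_field_derivative_transform_within_open[of "\<lambda>s. s - of_int n" _ _ "{of_int n<..}"])
         (use True in \<open>auto intro!: derivative_eq_intros\<close>)
  next
    case False
    show ?thesis
      by (rule has_field_derivative_transform_within_open[of "\<lambda>s. of_int n - s" _ _ "{..<of_int n}"])
         (use False n(2) in \<open>auto intro!: derivative_eq_intros\<close>)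
  qed
  then have "(zigzag has_real_derivative sgn (t - of_int n)) (at t)"
  proof (rule has_field_derivative_transform_within_open)
    show "open (ball (of_int n) (1/2) :: real set)" by simp
    show "t \<in> ball (of_int n) (1/2)" using n(1) by (simp add: dist_real_def abs_minus_commute)
    fix s :: real assume "s \<in> ball (of_int n) (1/2)"
    then have "round s = n"
      by (intro round_unique') (simp add: dist_real_def abs_minus_commute)
    then show "\<bar>s - of_int n\<bar> = zigzag s" by (simp add: zigzag_def)
  qed
  then show ?thesis by (simp add: n_def)
qed

text \<open>The exceptional points, where the rescaled zigzag may have kinks, lie on the countably
  many hyperplanes \<open>x\<^sub>j = k d / 2\<close>, each of which is negligible.\<close>

lemma AE_component_scaled_notin_Ints:
  fixes d :: real
  assumes "d \<noteq> 0"
  shows "AE x in (lborel :: (real ^ 'n) measure). 2 * (x $ j / d) \<notin> \<int>"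
proof -
  have "negligible (\<Union>k::int. {x :: real ^ 'n. x $ j = of_int k * d / 2})"
  proof (rule negligible_countable_Union)
    fix N assume "N \<in> range (\<lambda>k::int. {x :: real ^ 'n. x $ j = of_int k * d / 2})"
    then obtain k :: int where "N = {x. x $ j = of_int k * d / 2}" by blast
    then show "negligible N" by (simp only: cart_eq_inner_axis) (simp only: negligible_standard_hyperplane axis_in_Basis_iff Basis_real_def singleton_iff)
  qed simp
  then have "AE x in (lebesgue :: (real ^ 'n) measure). x \<notin> (\<Union>k::int. {x. x $ j = of_int k * d / 2})"
    by (simp only: negligible_iff_null_sets AE_not_in)
  then have "AE x in (lborel :: (real ^ 'n) measure). x \<notin> (\<Union>k::int. {x. x $ j = of_int k * d / 2})"
    by (simp only: AE_completion_iff)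
  then show ?thesis
  proof (rule AE_mp, intro AE_I2 impI notI)
    fix x :: "real ^ 'n"
    assume x: "x \<notin> (\<Union>k::int. {x. x $ j = of_int k * d / 2})" and "2 * (x $ j / d) \<in> \<int>"
    then obtain k :: int where "2 * (x $ j / d) = of_int k" by (auto elim: Ints_cases)
    with assms have "x $ j = of_int k * d / 2" by (simp add: field_simps)
    with x show False by blast
  qed
qed

lemma norm_axis: "norm (axis i x :: 'a::real_normed_vector ^ 'n) = norm x"
proof -
  have "(norm ((axis i x :: 'a ^ 'n) $ k))\<^sup>2 = (if k = i then (norm x)\<^sup>2 else 0)" for k
    by (simp add: axis_def)
  then show ?thesis
    unfolding norm_vec_def L2_set_def by simp
qed

section \<open>Rigidity for zero boundary values on the unit cube\<close>

lemma unit_cube_sets: "unit_cube \<in> sets lebesgue" "open unit_cube"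
  by (auto simp: unit_cube_def)

lemma unit_cube_box:
  "closure unit_cube = (cbox 0 1 :: (real ^ 'n) set)"
  "frontier unit_cube = (cbox 0 1 - box 0 1 :: (real ^ 'n) set)"
proof -
  have "(1/2) *\<^sub>R 1 \<in> (box 0 1 :: (real ^ 'n) set)" by (simp add: mem_box_cart)
  then have "(box 0 1 :: (real ^ 'n) set) \<noteq> {}" by blast
  then show "closure unit_cube = (cbox 0 1 :: (real ^ 'n) set)"
    "frontier unit_cube = (cbox 0 1 - box 0 1 :: (real ^ 'n) set)"
    by (simp_all add: unit_cube_def frontier_box)
qed

text \<open>The cube is open and nonempty, hence of positive measure. This extracts facts about
  constants such as \<open>A\<close> from statements that hold almost everywhere.\<close>

lemma unit_cube_AE_ex:
  assumes "AE x in lebesgue_on (unit_cube :: (real ^ 'n) set). P x"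
  shows "\<exists>x. P x"
proof -
  have "emeasure (lebesgue_on (unit_cube :: (real ^ 'n) set)) (space (lebesgue_on unit_cube)) = 
    emeasure lebesgue (unit_cube :: (real ^ 'n) set)"
    by (simp add: emeasure_restrict_space unit_cube_sets)
  also have "\<dots> \<noteq> 0"
  proof
    assume "emeasure lebesgue (unit_cube :: (real ^ 'n) set) = 0"
    then have "negligible (unit_cube :: (real ^ 'n) set)"
      by (auto simp: negligible_iff_null_sets unit_cube_sets)
    then have "unit_cube = ({} :: (real ^ 'n) set)"
      using unit_cube_sets(2) open_not_negligible by blast
    moreover have "(1/2) *\<^sub>R 1 \<in> (unit_cube :: (real ^ 'n) set)" by (simp add: unit_cube_def mem_box_cart)
    ultimately show False by blast
  qed
  finally have "ae_filter (lebesgue_on (unit_cube :: (real ^ 'n) set)) \<noteq> bot"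
    by (simp add: ae_filter_eq_bot_iff)
  then show ?thesis using assms by (rule eventually_happens')
qed

lemma integrable_unit_cube_Linf:
  fixes G :: "real ^ 'n \<Rightarrow> 'b::euclidean_space"
  assumes "Linf unit_cube G"
  shows "integrable (lebesgue_on unit_cube) G"
proof -
  have G: "G \<in> borel_measurable (lebesgue_on unit_cube)" "Linf_norm unit_cube G < \<infinity>"
    using assms by (auto simp: Linf_def)
  then obtain K :: real where K: "Linf_norm unit_cube G \<le> ereal K"
    by (metis ereal_dense2 less_imp_le)
  have "AE x in lebesgue_on unit_cube. ereal (norm (G x)) \<le> Linf_norm unit_cube G"
    unfolding Linf_norm_def by (rule esssup_AE)
  then have "AE x in lebesgue_on unit_cube. norm (G x) \<le> K"
    by (rule AE_mp) (use K in \<open>auto intro!: AE_I2 dest: order_trans\<close>)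
  moreover have "finite_measure (lebesgue_on (unit_cube :: (real ^ 'n) set))"
    by (intro finite_measureI) (simp add: emeasure_restrict_space unit_cube_sets, simp add: unit_cube_def emeasure_lborel_box_eq)
  ultimately show ?thesis
    using G(1) by (intro finite_measure.integrable_const_bound)
qed

text \<open>A constant derivative in the single direction \<open>j\<close> makes component
  \<open>i\<close> affine on all chords in that direction, and the zero boundary values then make it
  vanish throughout the cube. Therefore every column \<open>k\<close> of row \<open>i\<close> of the
  gradient vanishes as well.\<close>

lemma W1inf0_zero_component:
  fixes \<phi> :: "real ^ 'n \<Rightarrow> real ^ 'm"
  assumes W: "W1inf0 \<phi> G" and c: "AE x in lebesgue_on unit_cube. G x $ i $ j = c"
  shows "c = 0" "AE x in lebesgue_on unit_cube. G x $ i $ k = 0"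
proof -
  let ?M = "lebesgue_on (unit_cube :: (real ^ 'n) set)"
  have W': "continuous_on (cbox 0 1) \<phi>" "Linf unit_cube G" "weak_gradient unit_cube \<phi> G"
    "\<And>x. x \<in> cbox 0 1 - box 0 1 \<Longrightarrow> \<phi> x = 0"
    using W by (auto simp: W1inf0_def W1inf_def unit_cube_box)
  define u where "u x = \<phi> x $ i" for x
  have u: "continuous_on (cbox 0 1) u"
    unfolding u_def[abs_def] by (intro continuous_on_component W')
  have intG: "integrable ?M (\<lambda>x. G x $ i $ k)" for k
    using integrable_unit_cube_Linf[OF W'(2)] 
    by (intro integrable_bounded_linear[OF bounded_linear_vec_nth] integrable_bounded_linear[OF bounded_linear_vec_nth])
  have wk: "(LINT x|?M. u x * partial_deriv k \<psi> x) = - (LINT x|?M. G x $ i $ k * \<psi> x)"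
    if "test_function unit_cube \<psi>" for \<psi> k
    using W'(3) that by (simp add: weak_gradient_def u_def)
  have weak: "(LINT x|lebesgue_on (box 0 1). u x * partial_deriv j \<psi> x) = - (LINT x|lebesgue_on (box 0 1). c * \<psi> x)"
    if "test_function (box 0 1) \<psi>" for \<psi>
  proof -
    have [measurable]: "\<psi> \<in> borel_measurable ?M"
      by (intro measurable_restrict_space1 measurable_completion)
         (simp add: borel_measurable_continuous_onI test_functionD(1)[OF that])
    have [measurable]: "(\<lambda>x. G x $ i $ j) \<in> borel_measurable ?M"
      using intG by blast
    have "(LINT x|?M. G x $ i $ j * \<psi> x) = (LINT x|?M. c * \<psi> x)"
      by (rule integral_cong_AE) (use c in auto)
    with wk[of \<psi> j] that show ?thesis by (simp add: unit_cube_def)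
  qed
  have key: "c = 0 \<and> u p = 0" if p: "p \<in> box 0 1" for p
  proof -
    let ?f = "\<lambda>t. u (p + t *\<^sub>R axis j 1) - c * t"
    let ?S = "{- p $ j <..< 1 - p $ j}"
    have pj: "0 < p $ i" "p $ i < 1" for i using p by (auto simp: mem_box_cart)
    have cl: "closure ?S = {- p $ j .. 1 - p $ j}" by simp
    have inbox: "p + t *\<^sub>R axis j 1 \<in> cbox 0 1" if "t \<in> {- p $ j .. 1 - p $ j}" for t
      using that pj less_imp_le[OF pj(1)] less_imp_le[OF pj(2)] by (auto simp: mem_box_cart axis_def)
    \<comment> \<open>The affine formula is known only in the open box; \<open>?S\<close>
      parametrizes the open chord through \<open>p\<close>, and continuity carries the formula to
      its two ends on the boundary.\<close>
    have cont: "continuous_on (closure ?S) ?f"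
      unfolding cl using inbox
      by (intro continuous_on_diff continuous_on_compose2[OF u]) (auto intro!: continuous_intros)
    have const: "?f t = u p" if "t \<in> ?S" for t
    proof -
      have "p + t *\<^sub>R axis j 1 \<in> box 0 1"
        using that pj by (auto simp: mem_box_cart axis_def)
      from weak_constant_deriv_imp_affine[OF u weak p this] show ?thesis by simp
    qed
    have ends: "?f (- p $ j) = u p" "?f (1 - p $ j) = u p"
      by (rule continuous_constant_on_closure[OF cont const]; simp add: cl)+
    have zero: "u (p + t *\<^sub>R axis j 1) = 0" if "t = - p $ j \<or> t = 1 - p $ j" for t
    proof -
      have "p + t *\<^sub>R axis j 1 \<notin> box 0 1"
        using that by (auto simp: mem_box_cart axis_def intro!: exI[of _ j])
      then show ?thesis using W'(4) inbox[of t] that by (auto simp: u_def)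
    qed
    \<comment> \<open>Subtracting the two end point equations leaves \<open>c = 0\<close>, and then
      either one gives \<open>u p = 0\<close>.\<close>
    have "0 - c * (- p $ j) = u p" "0 - c * (1 - p $ j) = u p"
      using ends zero[of "- p $ j"] zero[of "1 - p $ j"] by metis+
    then show ?thesis by (auto simp: algebra_simps)
  qed
  have "(1/2) *\<^sub>R 1 \<in> (box 0 1 :: (real ^ 'n) set)" by (simp add: mem_box_cart)
  from key[OF this] show "c = 0" by simp
  show "AE x in ?M. G x $ i $ k = 0"
  proof (rule fundamental_lemma_calculus_of_variations[OF unit_cube_sets(2) intG])
    fix \<psi> :: "real ^ 'n \<Rightarrow> real" assume "test_function unit_cube \<psi>"
    then have "(LINT x|?M. G x $ i $ k * \<psi> x) = - (LINT x|?M. u x * partial_deriv k \<psi> x)"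
      by (simp add: wk)
    also have "(LINT x|?M. u x * partial_deriv k \<psi> x) = (LINT x|?M. 0)"
      by (rule Bochner_Integration.integral_cong) (use key in \<open>auto simp: unit_cube_def\<close>)
    finally show "(LINT x|?M. G x $ i $ k * \<psi> x) = 0" by simp
  qed
qed

section \<open>The indicator function that separates the two notions\<close>

lemma lower_semicontinuous_indicator_open:
  assumes "open S"
  shows "lower_semicontinuous (indicator S)"
  unfolding lower_semicontinuous_def
proof
  fix x
  show "ereal (indicator S x) \<le> Liminf (at x) (\<lambda>y. ereal (indicator S y))"
  proof (rule Liminf_bounded)
    show "\<forall>\<^sub>F y in at x. ereal (indicator S x) \<le> ereal (indicator S y)"
    proof (cases "x \<in> S")
      case True
      with assms have "\<forall>\<^sub>F y in at x. y \<in> S" by (simp add: eventually_at_in_open')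
      then show ?thesis by (rule eventually_mono) (use True in auto)
    qed simp
  qed
qed

text \<open>The set \<open>E\<close> of the overview. Column \<open>j\<close> offers two opposite
  slopes, enough to oscillate around zero, while column \<open>k\<close> is pinned, which makes row
  \<open>i\<close> rigid under zero boundary values.\<close>

definition two_slopes :: "'m \<Rightarrow> 'n \<Rightarrow> 'n \<Rightarrow> (real ^ 'n ^ 'm) set" where
  "two_slopes i j k = {X. \<bar>X $ i $ j\<bar> = 1 \<and> X $ i $ k = 0}"

lemma closed_two_slopes: "closed (two_slopes i j k)"
  unfolding two_slopes_def
  by (intro closed_Collect_conj closed_Collect_eq continuous_intros)

lemma weak_Morrey_quasiconvex_two_slopes:
  "weak_Morrey_quasiconvex (indicator (- two_slopes i j k) :: real ^ 'n ^ 'm \<Rightarrow> real)"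
  unfolding weak_Morrey_quasiconvex_def
proof (intro conjI allI impI)
  let ?f = "indicator (- two_slopes i j k) :: real ^ 'n ^ 'm \<Rightarrow> real"
  let ?M = "lebesgue_on (unit_cube :: (real ^ 'n) set)"
  show "?f \<in> borel_measurable borel"
    using closed_two_slopes[of i j k] by (intro borel_measurable_indicator) (auto intro: borel_closed)
  fix A and \<phi> :: "real ^ 'n \<Rightarrow> real ^ 'm" and G assume W: "W1inf0 \<phi> G"
  show "ereal (?f A) \<le> esssup ?M (\<lambda>x. ereal (?f (A + G x)))"
  proof (rule ccontr)
    assume "\<not> ?thesis"
    then have less: "esssup ?M (\<lambda>x. ereal (?f (A + G x))) < ereal (?f A)" by simp
    have "AE x in ?M. ereal (?f (A + G x)) \<le> esssup ?M (\<lambda>x. ereal (?f (A + G x)))"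
      by (rule esssup_AE)
    \<comment> \<open>As \<open>?f\<close> takes only the values 0 and 1, this strict inequality
      means that \<open>?f A = 1\<close> and that \<open>A + G x\<close> lies in
      \<open>two_slopes i j k\<close> almost everywhere.\<close>
    then have AE: "AE x in ?M. ?f (A + G x) < ?f A"
      by (rule AE_mp) (use less in \<open>auto intro!: AE_I2 dest: order_le_less_trans\<close>)
    then obtain x where "?f (A + G x) < ?f A" using unit_cube_AE_ex by blast
    then have A: "A \<notin> two_slopes i j k" by (auto simp: indicator_def split: if_splits)
    from AE have E: "AE x in ?M. A + G x \<in> two_slopes i j k"
      by (rule AE_mp) (auto intro!: AE_I2 simp: indicator_def split: if_splits)
    then have "AE x in ?M. G x $ i $ k = - (A $ i $ k)"
      by (rule AE_mp) (auto intro!: AE_I2 simp: two_slopes_def)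
    from W1inf0_zero_component[OF W this]
    have "A $ i $ k = 0" and "AE x in ?M. G x $ i $ j = 0" by auto
    from E this(2) have "AE x in ?M. A + G x \<in> two_slopes i j k \<and> G x $ i $ j = 0"
      by (rule AE_conjI)
    then obtain x where "A + G x \<in> two_slopes i j k" "G x $ i $ j = 0"
      using unit_cube_AE_ex by blast
    with \<open>A $ i $ k = 0\<close> A show False by (simp add: two_slopes_def)
  qed
qed

text \<open>Scaling argument and value of \<open>zigzag\<close> by the same \<open>d\<close>
  preserves the slopes 1 and -1 while the amplitude is at most \<open>d / 2\<close>. The gradient
  bound is therefore independent of \<open>d\<close>.\<close>

lemma W1inf_zigzag:
  fixes i :: "'m::finite" and j :: "'n::finite"
  assumes d: "d > 0"
  defines "\<phi> \<equiv> \<lambda>x :: real ^ 'n. axis i (d * zigzag (x $ j / d)) :: real ^ 'm"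
  defines "G \<equiv> \<lambda>x :: real ^ 'n. axis i (axis j (sgn (x $ j / d - of_int (round (x $ j / d))))) :: real ^ 'n ^ 'm"
  shows "W1inf \<phi> G" "Linf_norm unit_cube G \<le> 1"
proof -
  let ?M = "lebesgue_on (unit_cube :: (real ^ 'n) set)"
  have Lip: "\<bar>d * zigzag (x $ j / d) - d * zigzag (y $ j / d)\<bar> \<le> norm (x - y)" for x y :: "real ^ 'n"
  proof -
    have "\<bar>d * zigzag (x $ j / d) - d * zigzag (y $ j / d)\<bar> = d * \<bar>zigzag (x $ j / d) - zigzag (y $ j / d)\<bar>"
      using d by (simp add: right_diff_distrib[symmetric] abs_mult)
    also have "\<dots> \<le> d * \<bar>x $ j / d - y $ j / d\<bar>"
      using d by (intro mult_left_mono zigzag_Lipschitz) simp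
    also have "\<dots> = \<bar>(x - y) $ j\<bar>"
      using d by (simp add: diff_divide_distrib[symmetric])
    also have "\<dots> \<le> norm (x - y)" by (rule component_le_norm_cart)
    finally show ?thesis .
  qed
  have c\<phi>: "continuous_on S \<phi>" for S
  proof (rule lipschitz_on_continuous_on[of 1], rule lipschitz_onI)
    fix x y
    have "\<phi> x - \<phi> y = axis i (d * zigzag (x $ j / d) - d * zigzag (y $ j / d))"
      by (simp add: \<phi>_def vec_eq_iff axis_def)
    then show "dist (\<phi> x) (\<phi> y) \<le> 1 * dist x y"
      using Lip[of x y] by (simp add: dist_norm norm_axis)
  qed simp
  have sgn_meas [measurable]: "(\<lambda>x :: real ^ 'n. sgn (x $ j / d - of_int (round (x $ j / d)))) \<in> borel_measurable borel"
    unfolding round_def by measurable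
  have G_comp: "G x $ i' $ j' = (if i' = i \<and> j' = j then sgn (x $ j / d - of_int (round (x $ j / d))) else 0)" for x i' j'
    by (simp add: G_def axis_def)
  have meas: "(\<lambda>x. G x $ i' $ j') \<in> borel_measurable borel" for i' j'
    unfolding G_comp by (cases "i' = i \<and> j' = j") simp_all
  have "G = (\<lambda>x. sgn (x $ j / d - of_int (round (x $ j / d))) *\<^sub>R axis i (axis j 1))"
    by (simp add: G_def fun_eq_iff vec_eq_iff axis_def)
  then have "G \<in> borel_measurable borel"
    using sgn_meas by simp
  then have G_meas: "G \<in> borel_measurable ?M"
    by (intro measurable_restrict_space1 measurable_completion) simp
  have norm_G: "norm (G x) \<le> 1" for x
    by (simp add: G_def norm_axis sgn_if)
  show "Linf_norm unit_cube G \<le> 1"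
    unfolding Linf_norm_def by (rule esssup_I) (use G_meas norm_G in auto)
  then have "Linf unit_cube G"
    using G_meas by (auto simp: Linf_def)
  moreover have "Linf unit_cube \<phi>"
  proof -
    have m: "\<phi> \<in> borel_measurable ?M"
      by (intro measurable_restrict_space1 measurable_completion)
         (simp add: borel_measurable_continuous_onI c\<phi>)
    have "norm (\<phi> x) \<le> d" for x
      using zigzag_bounds[of "x $ j / d"] d by (simp add: \<phi>_def norm_axis abs_mult)
    then have "Linf_norm unit_cube \<phi> \<le> ereal d"
      unfolding Linf_norm_def by (intro esssup_I) (use m in auto)
    with m show ?thesis by (auto simp: Linf_def)
  qed
  moreover have "weak_gradient unit_cube \<phi> G"
    unfolding weak_gradient_def
  proof (intro allI impI)
    fix \<psi> :: "real ^ 'n \<Rightarrow> real" and i' j' assume \<psi>: "test_function unit_cube \<psi>"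
    show "(LINT x|?M. \<phi> x $ i' * partial_deriv j' \<psi> x) = - (LINT x|?M. G x $ i' $ j' * \<psi> x)"
    proof (rule test_function_Lipschitz_integration_by_parts[OF _ _ meas \<psi> unit_cube_sets(1)])
      show "\<bar>\<phi> x $ i' - \<phi> y $ i'\<bar> \<le> 1 * norm (x - y)" for x y
        using Lip[of x y] by (simp add: \<phi>_def axis_def)
      show "AE x in lborel. ((\<lambda>h. (\<phi> (x + h *\<^sub>R axis j' 1) $ i' - \<phi> x $ i') / h) \<longlongrightarrow> G x $ i' $ j') (at 0)"
        using AE_component_scaled_notin_Ints[of d j]
      proof (rule AE_mp)
        show "AE x in lborel. 2 * (x $ j / d) \<notin> \<int> \<longrightarrow>
            ((\<lambda>h. (\<phi> (x + h *\<^sub>R axis j' 1) $ i' - \<phi> x $ i') / h) \<longlongrightarrow> G x $ i' $ j') (at 0)"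
        proof (intro AE_I2 impI)
          fix x :: "real ^ 'n" assume x: "2 * (x $ j / d) \<notin> \<int>"
          show "((\<lambda>h. (\<phi> (x + h *\<^sub>R axis j' 1) $ i' - \<phi> x $ i') / h) \<longlongrightarrow> G x $ i' $ j') (at 0)"
          \<comment> \<open>Only entry \<open>(i, j)\<close> varies: the factors \<open>d\<close>
            and \<open>1 / d\<close> cancel in the chain rule. For every other entry the difference
            quotient is identically zero.\<close>
          proof (cases "i' = i \<and> j' = j")
            case True
            have "((\<lambda>h. d * zigzag ((x $ j + h) / d)) has_real_derivative
                d * (sgn (x $ j / d - of_int (round (x $ j / d))) * (1 / d))) (at 0)"
              by (rule DERIV_cmult, rule DERIV_chain2[of zigzag])
                 (use x zigzag_has_field_derivative[OF x] d in \<open>auto intro!: derivative_eq_intros\<close>)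
            with True d show ?thesis
              by (simp add: has_field_derivative_iff G_comp \<phi>_def)
          next
            case False
            then have "\<phi> (x + h *\<^sub>R axis j' 1) $ i' = \<phi> x $ i'" for h
              by (auto simp: \<phi>_def axis_def)
            with False show ?thesis by (auto simp: G_comp)
          qed
        qed
      qed (use d in simp)
    qed
  qed
  ultimately show "W1inf \<phi> G"
    using c\<phi> by (simp add: W1inf_def)
qed

lemma not_strong_Morrey_quasiconvex_two_slopes:
  fixes i :: "'m::finite" and j k :: "'n::finite"
  assumes "j \<noteq> k"
  shows "\<not> strong_Morrey_quasiconvex (indicator (- two_slopes i j k) :: real ^ 'n ^ 'm \<Rightarrow> real)"
proof
  let ?f = "indicator (- two_slopes i j k) :: real ^ 'n ^ 'm \<Rightarrow> real"
  let ?M = "lebesgue_on (unit_cube :: (real ^ 'n) set)"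
  assume "strong_Morrey_quasiconvex ?f"
  \<comment> \<open>At \<open>A = 0\<close> the function equals 1, while its essential supremum
    along the zigzag is at most 0, so the tolerance 1/2 gives a contradiction. \<open>K = 1\<close>
    is the gradient bound of the zigzag, and the \<open>\<delta>\<close> obtained serves as its
    scale \<open>d\<close>.\<close>
  from this[unfolded strong_Morrey_quasiconvex_def, THEN conjunct2, rule_format,
      where \<epsilon> = "1/2" and A = 0 and K = 1]
  obtain d where d: "d > 0" and strong: "\<And>\<phi> G. W1inf \<phi> G \<Longrightarrow> Linf_norm unit_cube G \<le> 1 \<Longrightarrow>
        (\<forall>x\<in>frontier unit_cube. norm (\<phi> x) \<le> d) \<Longrightarrow>
        ereal (?f 0) \<le> esssup ?M (\<lambda>x. ereal (?f (G x))) + ereal (1/2)"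
    by (auto simp: one_ereal_def)
  let ?\<phi> = "\<lambda>x :: real ^ 'n. axis i (d * zigzag (x $ j / d)) :: real ^ 'm"
  let ?G = "\<lambda>x :: real ^ 'n. axis i (axis j (sgn (x $ j / d - of_int (round (x $ j / d))))) :: real ^ 'n ^ 'm"
  have "norm (?\<phi> x) \<le> d" for x
    using zigzag_bounds[of "x $ j / d"] d by (simp add: norm_axis abs_mult)
  with strong[OF W1inf_zigzag[OF d, of i j]]
  have le: "ereal (?f 0) \<le> esssup ?M (\<lambda>x. ereal (?f (?G x))) + ereal (1/2)" by blast
  have "?G \<in> borel_measurable ?M"
    using W1inf_zigzag(1)[OF d, of i j] by (simp add: W1inf_def Linf_def)
  moreover have "?f \<in> borel_measurable borel"
    using closed_two_slopes[of i j k] by (intro borel_measurable_indicator) (auto intro: borel_closed)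
  ultimately have m: "(\<lambda>x. ereal (?f (?G x))) \<in> borel_measurable ?M"
    by measurable
  have "AE x in lebesgue. 2 * ((x :: real ^ 'n) $ j / d) \<notin> \<int>"
    using AE_component_scaled_notin_Ints[of d j] d by (intro AE_completion) simp
  then have "AE x in ?M. 2 * (x $ j / d) \<notin> \<int>"
    by (subst AE_restrict_space_iff) (auto simp: unit_cube_sets)
  then have "AE x in ?M. ereal (?f (?G x)) \<le> 0"
  proof (rule AE_mp, intro AE_I2 impI)
    fix x :: "real ^ 'n" assume "2 * (x $ j / d) \<notin> \<int>"
    then have "x $ j / d \<noteq> of_int (round (x $ j / d))"
      by (metis Ints_mult Ints_numeral Ints_of_int)
    then have "?G x \<in> two_slopes i j k"
      \<comment> \<open>Off the kinks the \<open>sgn\<close> is 1 or -1, and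
        \<open>j \<noteq> k\<close> makes the entry in column \<open>k\<close> zero.\<close>
      using assms by (simp add: two_slopes_def axis_def sgn_if)
    then show "ereal (?f (?G x)) \<le> 0" by simp
  qed
  with m have "esssup ?M (\<lambda>x. ereal (?f (?G x))) \<le> 0" by (rule esssup_I)
  then have "esssup ?M (\<lambda>x. ereal (?f (?G x))) + ereal (1/2) \<le> 0 + ereal (1/2)"
    by (rule add_right_mono)
  from order_trans[OF le this] have "ereal (?f 0) \<le> ereal (1/2)" by (simp only: add_0)
  then show False by (simp add: two_slopes_def)
qed

theorem mainTheorem1:
  assumes "CARD('m::finite) > 1" and "CARD('n::finite) > 1"
  shows "\<exists>f :: real ^ 'n ^ 'm \<Rightarrow> real.
           lower_semicontinuous f \<and> weak_Morrey_quasiconvex f \<and> \<not> strong_Morrey_quasiconvex f"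
proof -
  obtain j k :: 'n where jk: "j \<noteq> k"
    using assms(2) by (metis One_nat_def UNIV_I card_le_Suc0_iff_eq finite not_less)
  show ?thesis
    \<comment> \<open>Here \<open>undefined\<close> names an arbitrary row.\<close>
    by (intro exI[of _ "indicator (- two_slopes undefined j k)"] conjI weak_Morrey_quasiconvex_two_slopes
         lower_semicontinuous_indicator_open not_strong_Morrey_quasiconvex_two_slopes[OF jk])
       (simp add: open_Compl closed_two_slopes)
qed

end
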